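(* Let $m=1$, write $g=g_1$, let $\beta\in(0,1)$, and let $\{\epsilon_n\}\subset(0,\infty)$ satisfy $n\epsilon_n^2\ge 1$ for all $n\ge1$ and $\epsilon_n^2\to0$ as $n\to\infty$. Suppose that the loss functions $$L^1_n(\xi,\xi_0)=n\sup_{x\in\mathcal X}\left|\mathbb I_{(-\infty,0]}(g(x,\xi))-\mathbb I_{(-\infty,0]}(g(x,\xi_0))\right|,\qquad L^2_n(\xi,\xi_0)=n\sup_{x\in\mathcal X}|f(x,\xi)-f(x,\xi_0)|$$ both satisfy the test condition, that the prior satisfies the sieve-mass condition and the prior-mass condition, with $C>C_2+C_3+2$, that $f(\cdot,\xi)$ and $g(\cdot,\xi)$ are continuous on $\mathcal X$ for almost every $\xi\in\Theta$, and that $\mathcal X$ is compact. Then there exist fixed constants $M_1>0$ and $M_2>0$ such that for all $n\ge1$, any $\eta>0$ and any $\delta\in(0,\beta)$, $$P_0^n\left[\,|V^*_{VB}(\mathbf X_n)-V^*|>2\eta\,\right]\le\left[\frac{M_1}{\min(\delta,1-\beta)}+\frac{M_2}{\eta}\right](\epsilon_n^2+\eta_n^2),$$ where $\eta_n^2:=\frac1n\inf_{q\in\mathcal Q}\mathbb E_{P_0^n}\left[\int_\Theta q(\xi)\log\frac{q(\xi)}{\pi(\xi|\mathbf X_n)}\,d\xi\right]$.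
   Context: Setting. $\mathcal X\subseteq\mathbb R^p$ is a convex decision set, $\Theta\subseteq\mathbb R^q$ a parameter set, $\xi_0\in\Theta$ the true parameter, and $f,g_i:\mathcal X\times\mathbb R^q\to\mathbb R$ ($i=1,\dots,m$) are cost and constraint functions. For each $n\ge1$, $\{P^n_\xi:\xi\in\Theta\}$ is a family of probability distributions on $\mathbb R^{d\times n}$ with densities $p^n_\xi$; the data $\mathbf X_n=(X_1,\dots,X_n)$ (not necessarily i.i.d.) are drawn from $P_0^n:=P^n_{\xi_0}$. $\Pi$ is a prior distribution on $\Theta$ with density $\pi$; the posterior density is $\pi(\xi|\mathbf X_n)=p^n_\xi(\mathbf X_n)\pi(\xi)/\int p^n_{\xi}(\mathbf X_n)\pi(\xi)d\xi$. The variational family $\mathcal Q$ is a class of probability densities on $\Theta$, the variational Bayes (VB) posterior is a minimizer $q^*(\cdot|\mathbf X_n)\in\arg\min_{q\in\mathcal Q}\mathrm{KL}(q(\xi)\|\pi(\xi|\mathbf X_n))$, where $\mathrm{KL}(q\|r)=\int q\log(q/r)$, and $Q^*(A|\mathbf X_n)=\int_A q^*(\xi|\mathbf X_n)d\xi$ for $A\subseteq\Theta$. $\mathbb I_A$ is the indicator function of a set $A$. Optimal values ($m=1$). $V^*$ is the optimal value of: minimize $f(x,\xi_0)$ over $x\in\mathcal X$ subject to $g(x,\xi_0)\le0$; this problem is assumed to have a solution. $V^*_{VB}(\mathbf X_n)$ is the optimal value of: minimize $\mathbb E_{q^*(\xi|\mathbf X_n)}[f(x,\xi)]$ over $x\in\mathcal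 X$ subject to $Q^*(g(x,\xi)\le0\,|\,\mathbf X_n)\ge\beta$ (with value $+\infty$ if infeasible). Conditions, with positive constants $C,C_0,C_1,C_2,C_3$ not depending on $n$ or $\epsilon$. Test condition for a loss $L_n(\cdot,\cdot)\ge0$: for every $n\ge 1$ and every $\epsilon>\epsilon_n$ there exist a measurable function (test) $\phi_{n,\epsilon}$ of $\mathbf X_n$ with values in $[0,1]$ and a set (sieve) $\Theta_n(\epsilon)\subseteq\Theta$ such that (i) $\mathbb E_{P_0^n}[\phi_{n,\epsilon}]\le C_0\exp(-Cn\epsilon^2)$, and (ii) $\sup_{\{\xi\in\Theta_n(\epsilon):\,L_n(\xi,\xi_0)\ge C_1n\epsilon^2\}}\mathbb E_{P^n_\xi}[1-\phi_{n,\epsilon}]\le\exp(-Cn\epsilon^2)$. Sieve-mass condition: $\Pi(\Theta\setminus\Theta_n(\epsilon))\le\exp(-Cn\epsilon^2)$ for every $n\ge 1$ and $\epsilon>\epsilon_n$, for the sieves $\Theta_n(\epsilon)$ of the test condition. Prior-mass condition: for some fixed $\lambda>0$ and every $n\ge 1$, $\Pi(A_n)\ge\exp(-nC_2\epsilon_n^2)$, where $A_n=\{\xi\in\Theta:D_{1+\lambda}(P_0^n\|P^n_\xi)\le C_3n\epsilon_n^2\}$ and $D_{1+\lambda}(P_0^n\|P_\xi^n)=\frac1\lambda\log\int\left(\frac{dP_0^n}{dP_\xi^n}\right)^{\lambda}dP_0^n$ is the Rényi divergence ($P_0^n$ absolutely continuous with respect to $P_\xi^n$). *)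

theory Defs
  imports "HOL-Analysis.Analysis"
begin

definition param_measure :: "(real^'q) set \<Rightarrow> (real^'q) measure" where
  "param_measure \<Theta> = restrict_space lborel \<Theta>"

text \<open>The data \<open>(X\<^sub>1, \<dots>, X\<^sub>n)\<close>, a \<open>d \<times> n\<close> matrix, is the family of its columns, an
  element of the product space indexed by \<open>{1..n}\<close>. This is Lebesgue measure on that space.\<close>

definition data_measure :: "nat \<Rightarrow> (nat \<Rightarrow> real^'d) measure" where
  "data_measure n = PiM {1..n} (\<lambda>_. lborel)"

definition prob_density_on :: "'a measure \<Rightarrow> ('a \<Rightarrow> real) \<Rightarrow> bool" where
  "prob_density_on M h \<longleftrightarrow>
     h \<in> borel_measurable M \<and> (\<forall>x\<in>space M. 0 \<le> h x) \<and> (\<integral>\<^sup>+x. ennreal (h x) \<partial>M) = 1"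

definition dens_measure :: "'a measure \<Rightarrow> ('a \<Rightarrow> real) \<Rightarrow> 'a measure" where
  "dens_measure M h = density M (\<lambda>x. ennreal (h x))"

text \<open>The integral of an extended real function as the difference of the integrals of its positive
  and negative parts (\<open>e2ennreal\<close> maps negative numbers to \<open>0\<close>). Unlike the Bochner integral it
  takes the value \<open>\<infinity>\<close> when only the positive part has infinite integral.\<close>

definition ext_integral :: "'a measure \<Rightarrow> ('a \<Rightarrow> ereal) \<Rightarrow> ereal" where
  "ext_integral M h =
     enn2ereal (\<integral>\<^sup>+x. e2ennreal (h x) \<partial>M) - enn2ereal (\<integral>\<^sup>+x. e2ennreal (- h x) \<partial>M)"

text \<open>The integrand \<open>a log (a / b)\<close> of the Kullback--Leibler divergence, with the usual conventions
  \<open>0 log (0 / b) = 0\<close> and \<open>a log (a / 0) = \<infinity>\<close> for \<open>a > 0\<close>.\<close>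

definition kl_term :: "real \<Rightarrow> real \<Rightarrow> ereal" where
  "kl_term a b = (if a = 0 then 0 else if b = 0 then \<infinity> else ereal (a * ln (a / b)))"

definition KL :: "'a measure \<Rightarrow> ('a \<Rightarrow> real) \<Rightarrow> ('a \<Rightarrow> real) \<Rightarrow> ereal" where
  "KL M q r = ext_integral M (\<lambda>x. kl_term (q x) (r x))"

text \<open>\<open>D\<^bsub>1+l\<^esub>(P \<parallel> Q)\<close>, equal to \<open>\<infinity>\<close> unless \<open>P\<close> is absolutely continuous with respect to \<open>Q\<close>.
  In the library's argument order, \<open>dP/dQ\<close> is \<open>RN_deriv Q P\<close>, and \<open>absolutely_continuous Q P\<close>
  says that \<open>Q\<close>-null sets are \<open>P\<close>-null.\<close>

definition renyi_divergence :: "real \<Rightarrow> 'a measure \<Rightarrow> 'a measure \<Rightarrow> ereal" where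
  "renyi_divergence l P Q =
     (let I = (\<integral>\<^sup>+x. ennreal (enn2real (RN_deriv Q P x) powr l) \<partial>P)
      in if absolutely_continuous Q P \<and> I < \<infinity> then ereal (1 / l * ln (enn2real I)) else \<infinity>)"

definition posterior ::
  "(real^'q) set \<Rightarrow> (real^'q \<Rightarrow> real) \<Rightarrow> (real^'q \<Rightarrow> 'x \<Rightarrow> real) \<Rightarrow> 'x \<Rightarrow> real^'q \<Rightarrow> real" where
  "posterior \<Theta> \<pi> p X \<xi> = p \<xi> X * \<pi> \<xi> / (\<integral>\<zeta>. p \<zeta> X * \<pi> \<zeta> \<partial>param_measure \<Theta>)"

text \<open>The infimum over the empty set is \<open>\<infinity>\<close>, the value of an infeasible problem.\<close>

definition opt_value :: "('a \<Rightarrow> ereal) \<Rightarrow> 'a set \<Rightarrow> ereal" where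
  "opt_value F S = (INF x\<in>S. F x)"

definition true_value ::
  "'a set \<Rightarrow> ('a \<Rightarrow> 'b \<Rightarrow> real) \<Rightarrow> ('a \<Rightarrow> 'b \<Rightarrow> real) \<Rightarrow> 'b \<Rightarrow> ereal" where
  "true_value \<X> f g \<xi>\<^sub>0 = opt_value (\<lambda>x. ereal (f x \<xi>\<^sub>0)) {x\<in>\<X>. g x \<xi>\<^sub>0 \<le> 0}"

text \<open>The value of the chance-constrained problem under the probability density \<open>q\<close> on \<open>\<Theta>\<close>.\<close>

definition VB_value ::
  "'a set \<Rightarrow> (real^'q) set \<Rightarrow> ('a \<Rightarrow> real^'q \<Rightarrow> real) \<Rightarrow> ('a \<Rightarrow> real^'q \<Rightarrow> real) \<Rightarrow> real
     \<Rightarrow> (real^'q \<Rightarrow> real) \<Rightarrow> ereal" where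
  "VB_value \<X> \<Theta> f g \<beta> q =
     opt_value (\<lambda>x. ext_integral (dens_measure (param_measure \<Theta>) q) (\<lambda>\<xi>. ereal (f x \<xi>)))
       {x\<in>\<X>. measure (dens_measure (param_measure \<Theta>) q) {\<xi>\<in>\<Theta>. g x \<xi> \<le> 0} \<ge> \<beta>}"

definition loss1 :: "'a set \<Rightarrow> ('a \<Rightarrow> 'b \<Rightarrow> real) \<Rightarrow> nat \<Rightarrow> 'b \<Rightarrow> 'b \<Rightarrow> ennreal" where
  "loss1 \<X> g n \<xi> \<xi>\<^sub>0 =
     of_nat n * (SUP x\<in>\<X>. ennreal \<bar>indicator {..0} (g x \<xi>) - indicator {..0} (g x \<xi>\<^sub>0)\<bar>)"

definition loss2 :: "'a set \<Rightarrow> ('a \<Rightarrow> 'b \<Rightarrow> real) \<Rightarrow> nat \<Rightarrow> 'b \<Rightarrow> 'b \<Rightarrow> ennreal" where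
  "loss2 \<X> f n \<xi> \<xi>\<^sub>0 = of_nat n * (SUP x\<in>\<X>. ennreal \<bar>f x \<xi> - f x \<xi>\<^sub>0\<bar>)"

text \<open>The test condition, with the sieves \<open>S n e\<close> as an explicit parameter so that the sieve-mass
  condition can refer to them. They are required to be Borel so that their prior mass is defined.\<close>

definition test_condition ::
  "(real^'q) set \<Rightarrow> real^'q \<Rightarrow> (nat \<Rightarrow> real^'q \<Rightarrow> 'x measure) \<Rightarrow>
   (nat \<Rightarrow> real^'q \<Rightarrow> real^'q \<Rightarrow> ennreal) \<Rightarrow> (nat \<Rightarrow> real) \<Rightarrow> (nat \<Rightarrow> real \<Rightarrow> (real^'q) set) \<Rightarrow>
   real \<Rightarrow> real \<Rightarrow> real \<Rightarrow> bool" where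
  "test_condition \<Theta> \<xi>\<^sub>0 P L \<epsilon> S C C0 C1 \<longleftrightarrow>
     (\<forall>n\<ge>1. \<forall>e>\<epsilon> n. S n e \<in> sets borel \<and> S n e \<subseteq> \<Theta> \<and>
        (\<exists>\<phi>\<in>borel_measurable (P n \<xi>\<^sub>0). (\<forall>X. 0 \<le> \<phi> X \<and> \<phi> X \<le> (1::real)) \<and>
           (\<integral>\<^sup>+X. ennreal (\<phi> X) \<partial>P n \<xi>\<^sub>0) \<le> ennreal (C0 * exp (- C * real n * e\<^sup>2)) \<and>
           (SUP \<xi>\<in>{\<xi>\<in>S n e. L n \<xi> \<xi>\<^sub>0 \<ge> ennreal (C1 * real n * e\<^sup>2)}.
              \<integral>\<^sup>+X. ennreal (1 - \<phi> X) \<partial>P n \<xi>) \<le> ennreal (exp (- C * real n * e\<^sup>2))))"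

definition sieve_mass_condition ::
  "(real^'q) set \<Rightarrow> (real^'q \<Rightarrow> real) \<Rightarrow> (nat \<Rightarrow> real) \<Rightarrow> (nat \<Rightarrow> real \<Rightarrow> (real^'q) set) \<Rightarrow> real \<Rightarrow> bool" where
  "sieve_mass_condition \<Theta> \<pi> \<epsilon> S C \<longleftrightarrow>
     (\<forall>n\<ge>1. \<forall>e>\<epsilon> n.
        measure (dens_measure (param_measure \<Theta>) \<pi>) (\<Theta> - S n e) \<le> exp (- C * real n * e\<^sup>2))"

definition prior_mass_condition ::
  "(real^'q) set \<Rightarrow> (real^'q \<Rightarrow> real) \<Rightarrow> real^'q \<Rightarrow> (nat \<Rightarrow> real^'q \<Rightarrow> 'x measure) \<Rightarrow>
   (nat \<Rightarrow> real) \<Rightarrow> real \<Rightarrow> real \<Rightarrow> real \<Rightarrow> bool" where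
  "prior_mass_condition \<Theta> \<pi> \<xi>\<^sub>0 P \<epsilon> l C2 C3 \<longleftrightarrow>
     (\<forall>n\<ge>1. measure (dens_measure (param_measure \<Theta>) \<pi>)
          {\<xi>\<in>\<Theta>. renyi_divergence l (P n \<xi>\<^sub>0) (P n \<xi>) \<le> ereal (C3 * real n * (\<epsilon> n)\<^sup>2)}
        \<ge> exp (- real n * C2 * (\<epsilon> n)\<^sup>2))"

text \<open>\<open>\<eta>\<^sub>n\<^sup>2\<close>, as an extended real.\<close>

definition eta_sq ::
  "(real^'q) set \<Rightarrow> (real^'q \<Rightarrow> real) \<Rightarrow> (real^'q \<Rightarrow> real) set \<Rightarrow> real^'q
     \<Rightarrow> (nat \<Rightarrow> real^'q \<Rightarrow> (nat \<Rightarrow> real^'d) \<Rightarrow> real) \<Rightarrow> nat \<Rightarrow> ereal" where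
  "eta_sq \<Theta> \<pi> \<Q> \<xi>\<^sub>0 p n =
     ereal (1 / real n) *
       (INF q\<in>\<Q>. ext_integral (dens_measure (data_measure n) (p n \<xi>\<^sub>0))
          (\<lambda>X. KL (param_measure \<Theta>) q (posterior \<Theta> \<pi> (p n) X)))"

end

theory Submission
  imports Defs
begin

text \<open>The loss functions are chosen so that their averages under a probability density \<open>q\<close> on the
  parameters control the optimal value. The first loss divided by \<open>n\<close> indicates that the feasible sets
  at \<open>\<xi>\<close> and \<open>\<xi>\<^sub>0\<close> differ; if its average is below \<open>min \<delta> (1 - \<beta>)\<close>, then the chance constraint at
  level \<open>\<beta>\<close> is equivalent to feasibility at \<open>\<xi>\<^sub>0\<close>. The second loss divided by \<open>n\<close> is the uniform
  distance of the objectives, and so its average bounds the difference of the two infima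
  (\<open>chance_constrained_value_stable\<close>). Markov's inequality therefore reduces the theorem to a bound of
  order \<open>\<epsilon>\<^sup>2 + \<eta>\<^sup>2\<close> on the expected average of either loss, divided by \<open>n\<close>, under the variational
  posterior.

  That bound combines two facts. Relative entropy obeys \<open>\<integral> q log W \<le> KL q r + \<integral> r W\<close>
  (\<open>KL_nonneg_and_variational_bound\<close>), where \<open>r\<close> is the exact posterior; since \<open>q\<close> minimises the
  divergence, \<open>KL q r\<close> may be replaced by its value at any competitor, whose expectation enters the
  infimum \<open>n \<eta>\<^sup>2\<close>. And the exact posterior has exponential moments of the loss: there is a
  measurable \<open>W\<close> such that the loss is at most a constant times \<open>n \<epsilon>\<^sup>2 + log W\<close> while the
  expectation of \<open>\<integral> r W\<close> is bounded by a constant (\<open>posterior_loss_majorant\<close>). It comes from the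
  exponential decay of the expected posterior mass of large losses (\<open>post_mass_tail\<close>), which rests on
  the tests, the sieves, and a lower bound for the evidence obtained from the Renyi ball of the prior
  mass condition (\<open>evidence_lower_tail\<close>).

  Measurability of the losses, of the minimiser as a function of the data and of the deviation event
  is sidestepped: the losses are majorised by measurable functions of the parameter, and the event is
  covered, for one competitor at a time, by level sets of measurable functions of the data.\<close>

section \<open>The variational inequality for relative entropy\<close>

text \<open>The logarithm on \<open>[1, \<infinity>]\<close>; on \<open>[0, 1)\<close> negative values are cut off to \<open>0\<close>.\<close>
definition ln_ennreal :: "ennreal \<Rightarrow> ennreal" where
  "ln_ennreal w = (if w = \<infinity> then \<infinity> else ennreal (ln (enn2real w)))"

lemma ln_ennreal_measurable [measurable]: "ln_ennreal \<in> borel_measurable borel"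
  unfolding ln_ennreal_def by measurable

text \<open>This is the Fenchel--Young inequality \<open>a h + a \<le> a log (a / b) + b exp h\<close> for the conjugate pair
  \<open>a log a - a\<close> and \<open>exp h\<close>, at \<open>h = log w\<close>. The two signs of the divergence integrand are kept on
  different sides, so that everything is nonnegative and the infinite cases can be integrated too.\<close>
lemma kl_term_young:
  assumes "0 \<le> a" "0 \<le> b" "1 \<le> w"
  shows "ennreal a * ln_ennreal w + ennreal a + e2ennreal (- kl_term a b)
    \<le> e2ennreal (kl_term a b) + ennreal b * w"
proof (cases "a = 0 \<or> b = 0 \<or> w = \<infinity>")
  case True
  then show ?thesis
    using assms by (auto simp: kl_term_def ln_ennreal_def ennreal_mult_top e2ennreal_infty)
next
  case False
  then have ab: "0 < a" "0 < b" using assms by auto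
  obtain v where v: "w = ennreal v" "1 \<le> v"
    using False assms(3) by (cases w) (auto simp flip: ennreal_1)
  define y where "y = a * ln (a / b)"
  have "ln (b * v / a) \<le> b * v / a - 1"
    by (rule ln_le_minus_one) (use ab v in auto)
  then have "a * ln (b * v / a) \<le> a * (b * v / a - 1)"
    using ab by (intro mult_left_mono) auto
  also have "\<dots> = b * v - a" using ab by (simp add: field_simps)
  also have "ln (b * v / a) = ln v - ln (a / b)"
    using ab v by (simp add: ln_div ln_mult)
  finally have "a * ln v + a \<le> y + b * v" by (simp add: y_def algebra_simps)
  then have *: "a * ln v + a + max 0 (- y) \<le> max 0 y + b * v" by (simp add: max_def)
  have eq: "e2ennreal (kl_term a b) = ennreal (max 0 y)" "e2ennreal (- kl_term a b) = ennreal (max 0 (- y))"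
    using ab by (auto simp: kl_term_def y_def e2ennreal_ereal max_def ennreal_neg)
  have "ennreal a * ln_ennreal w + ennreal a + e2ennreal (- kl_term a b) = ennreal (a * ln v + a + max 0 (- y))"
    unfolding eq using ab v by (simp add: ln_ennreal_def ennreal_mult ennreal_plus)
  also have "\<dots> \<le> ennreal (max 0 y + b * v)" by (rule ennreal_leI) (rule *)
  also have "\<dots> = e2ennreal (kl_term a b) + ennreal b * w"
    unfolding eq using ab v by (simp add: ennreal_mult ennreal_plus)
  finally show ?thesis .
qed

lemma kl_term_measurable [measurable (raw)]:
  assumes [measurable]: "q \<in> borel_measurable M" "r \<in> borel_measurable M"
  shows "(\<lambda>x. kl_term (q x) (r x)) \<in> borel_measurable M"
  unfolding kl_term_def by measurable

text \<open>Integrating the Fenchel--Young inequality gives the Gibbs variational bound with the moment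
  \<open>\<integral> r w\<close> where the sharp form has its logarithm. Since \<open>log y \<le> y\<close> this loses only a constant,
  and being linear in \<open>r\<close> it can be averaged over the data without Jensen's inequality. The case
  \<open>w = 1\<close> says that the negative part of the divergence never exceeds its positive part.\<close>
lemma KL_nonneg_and_variational_bound:
  assumes q: "prob_density_on M q" and r: "prob_density_on M r"
  shows "0 \<le> KL M q r"
    and "w \<in> borel_measurable M \<Longrightarrow> (\<And>x. x \<in> space M \<Longrightarrow> 1 \<le> w x) \<Longrightarrow>
      (\<integral>\<^sup>+x. ennreal (q x) * ln_ennreal (w x) \<partial>M) \<le> e2ennreal (KL M q r) + (\<integral>\<^sup>+x. ennreal (r x) * w x \<partial>M)"
proof -
  have [measurable]: "q \<in> borel_measurable M" "r \<in> borel_measurable M"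
    and pos: "\<And>x. x \<in> space M \<Longrightarrow> 0 \<le> q x" "\<And>x. x \<in> space M \<Longrightarrow> 0 \<le> r x"
    and one: "(\<integral>\<^sup>+x. ennreal (q x) \<partial>M) = 1" "(\<integral>\<^sup>+x. ennreal (r x) \<partial>M) = 1"
    using q r by (auto simp: prob_density_on_def)
  define kp where "kp = (\<integral>\<^sup>+x. e2ennreal (kl_term (q x) (r x)) \<partial>M)"
  define kn where "kn = (\<integral>\<^sup>+x. e2ennreal (- kl_term (q x) (r x)) \<partial>M)"
  have KL: "KL M q r = enn2ereal kp - enn2ereal kn"
    by (simp add: KL_def ext_integral_def kp_def kn_def)
  \<comment> \<open>The summand \<open>1\<close> is the mass of \<open>q\<close>; it cancels against the mass of \<open>r\<close> when \<open>w = 1\<close>.\<close>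
  have main: "(\<integral>\<^sup>+x. ennreal (q x) * ln_ennreal (w x) \<partial>M) + 1 + kn \<le> kp + (\<integral>\<^sup>+x. ennreal (r x) * w x \<partial>M)"
    if [measurable]: "w \<in> borel_measurable M" and w: "\<And>x. x \<in> space M \<Longrightarrow> 1 \<le> w x" for w
  proof -
    have "(\<integral>\<^sup>+x. ennreal (q x) * ln_ennreal (w x) + ennreal (q x) + e2ennreal (- kl_term (q x) (r x)) \<partial>M)
      \<le> (\<integral>\<^sup>+x. e2ennreal (kl_term (q x) (r x)) + ennreal (r x) * w x \<partial>M)"
      by (intro nn_integral_mono kl_term_young pos w)
    then show ?thesis
      by (simp add: nn_integral_add one kp_def kn_def)
  qed
  have "1 + kn \<le> 1 + kp"
    using main[of "\<lambda>_. 1"] by (simp add: ln_ennreal_def one add.commute)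
  then have le: "kn \<le> kp" by simp
  show "0 \<le> KL M q r"
    unfolding KL using le by (intro ereal_diff_positive) (simp add: enn2ereal_nonneg less_eq_ennreal.rep_eq)
  show "(\<integral>\<^sup>+x. ennreal (q x) * ln_ennreal (w x) \<partial>M) \<le> e2ennreal (KL M q r) + (\<integral>\<^sup>+x. ennreal (r x) * w x \<partial>M)"
    if "w \<in> borel_measurable M" and w: "\<And>x. x \<in> space M \<Longrightarrow> 1 \<le> w x"
  proof (cases "kp = \<infinity>")
    case True
    then have "e2ennreal (KL M q r) = \<infinity>"
      by (simp add: KL e2ennreal_infty)
    then show ?thesis by simp
  next
    case False
    then obtain a b where ab: "kp = ennreal a" "kn = ennreal b" "0 \<le> a" "0 \<le> b" "b \<le> a"
      using le by (cases kp; cases kn) (auto simp: top_unique)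
    have eq: "e2ennreal (KL M q r) = ennreal (a - b)"
      unfolding KL ab(1,2) using ab by (simp add: enn2ereal_ennreal e2ennreal_ereal)
    define L where "L = (\<integral>\<^sup>+x. ennreal (q x) * ln_ennreal (w x) \<partial>M)"
    define R where "R = (\<integral>\<^sup>+x. ennreal (r x) * w x \<partial>M)"
    have "L + 1 + kn \<le> kp + R" using main[OF that] by (simp add: L_def R_def)
    then have "L + kn \<le> kp + R"
      by (meson add_increasing2 add_right_mono dual_order.trans order_refl zero_le_one)
    also have "kp = ennreal (a - b) + kn" using ab by (simp flip: ennreal_plus)
    finally have "ennreal b + L \<le> ennreal b + (ennreal (a - b) + R)"
      by (simp add: ab add_ac)
    then show ?thesis unfolding eq L_def[symmetric] R_def[symmetric]
      by simp
  qed
qed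

section \<open>Dominated models and their posterior mass\<close>

text \<open>The graph of the convex function \<open>y \<mapsto> y powr - l\<close> lies above its tangent at \<open>t\<close>. Integrated
  against a probability measure it replaces Jensen's inequality for this function, and it stays
  meaningful when the function takes the value \<open>\<infinity>\<close>.\<close>
lemma tangent_inequality:
  fixes l t y :: real
  assumes "0 < l" "0 < t" "0 < y"
  shows "(1 + l) * t powr - l \<le> y powr - l + l * t powr (- l - 1) * y"
proof -
  define z where "z = y / t"
  have z: "0 < z" "y = t * z" using assms by (auto simp: z_def)
  have "1 + l \<le> 1 + (- l * ln z) + l * z"
    using mult_left_mono[OF ln_le_minus_one[OF z(1)], of l] assms by (simp add: algebra_simps)
  also have "\<dots> \<le> exp (- l * ln z) + l * z"
    using exp_ge_add_one_self[of "- l * ln z"] by (intro add_mono) auto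
  also have "\<dots> = z powr - l + l * z" using z by (simp add: powr_def)
  finally have "(1 + l) * t powr - l \<le> (z powr - l + l * z) * t powr - l"
    by (intro mult_right_mono) auto
  also have "\<dots> = y powr - l + l * t powr (- l - 1) * y"
    using z assms by (simp add: powr_mult powr_diff algebra_simps)
  finally show ?thesis .
qed

text \<open>\<open>M\<close> dominates the prior on the parameters and \<open>N\<close> the distributions of the data. Joint
  measurability of the likelihood makes Fubini's theorem available for exchanging the two.\<close>
locale dominated_model = pair_sigma_finite M N
  for M :: "'a measure" and N :: "'x measure" +
  fixes p :: "'a \<Rightarrow> 'x \<Rightarrow> real" and \<pi> :: "'a \<Rightarrow> real"
  assumes likelihood_measurable: "(\<lambda>(\<xi>, X). p \<xi> X) \<in> borel_measurable (M \<Otimes>\<^sub>M N)"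
    and likelihood_density: "\<And>\<xi>. \<xi> \<in> space M \<Longrightarrow> prob_density_on N (p \<xi>)"
    and prior_density: "prob_density_on M \<pi>"
begin

definition evidence :: "'x \<Rightarrow> ennreal" where
  "evidence X = (\<integral>\<^sup>+\<xi>. ennreal (p \<xi> X * \<pi> \<xi>) \<partial>M)"

definition post :: "'x \<Rightarrow> 'a \<Rightarrow> real" where
  "post X \<xi> = p \<xi> X * \<pi> \<xi> / (\<integral>\<zeta>. p \<zeta> X * \<pi> \<zeta> \<partial>M)"

lemma prior_measurable [measurable]: "\<pi> \<in> borel_measurable M"
  and prior_nonneg: "\<xi> \<in> space M \<Longrightarrow> 0 \<le> \<pi> \<xi>"
  and prior_total: "(\<integral>\<^sup>+\<xi>. ennreal (\<pi> \<xi>) \<partial>M) = 1"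
  using prior_density by (auto simp: prob_density_on_def)

lemma likelihood_nonneg: "\<xi> \<in> space M \<Longrightarrow> X \<in> space N \<Longrightarrow> 0 \<le> p \<xi> X"
  and likelihood_total: "\<xi> \<in> space M \<Longrightarrow> (\<integral>\<^sup>+X. ennreal (p \<xi> X) \<partial>N) = 1"
  using likelihood_density by (auto simp: prob_density_on_def)

lemma likelihood_measurable' [measurable (raw)]:
  assumes [measurable]: "f \<in> measurable L M" "h \<in> measurable L N"
  shows "(\<lambda>x. p (f x) (h x)) \<in> borel_measurable L"
  using measurable_compose[OF measurable_Pair[OF assms] likelihood_measurable] by simp

lemma evidence_measurable [measurable]: "evidence \<in> borel_measurable N"
  unfolding evidence_def by measurable

lemma emeasure_prior:
  "A \<in> sets M \<Longrightarrow> emeasure (dens_measure M \<pi>) A = (\<integral>\<^sup>+\<xi>. ennreal (\<pi> \<xi>) * indicator A \<xi> \<partial>M)"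
  by (simp add: dens_measure_def emeasure_density)

lemma emeasure_prior_le_1: "emeasure (dens_measure M \<pi>) A \<le> 1"
proof -
  have "emeasure (dens_measure M \<pi>) A \<le> emeasure (dens_measure M \<pi>) (space (dens_measure M \<pi>))"
    by (rule emeasure_space)
  also have "\<dots> = 1"
    by (simp add: dens_measure_def emeasure_density prior_total cong: nn_integral_cong)
  finally show ?thesis .
qed

lemma emeasure_prior_eq: "emeasure (dens_measure M \<pi>) A = ennreal (measure (dens_measure M \<pi>) A)"
  by (rule emeasure_eq_ennreal_measure) (metis emeasure_prior_le_1 ennreal_one_neq_top top.extremum_unique)

lemma AE_evidence_finite: "AE X in N. evidence X < \<infinity>"
proof -
  have "(\<integral>\<^sup>+X. evidence X \<partial>N) = (\<integral>\<^sup>+\<xi>. (\<integral>\<^sup>+X. ennreal (p \<xi> X * \<pi> \<xi>) \<partial>N) \<partial>M)"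
    unfolding evidence_def by (rule Fubini') measurable
  also have "\<dots> = (\<integral>\<^sup>+\<xi>. ennreal (\<pi> \<xi>) \<partial>M)"
    by (intro nn_integral_cong)
       (simp add: ennreal_mult likelihood_nonneg prior_nonneg nn_integral_multc likelihood_total
         cong: nn_integral_cong_simp)
  finally have "(\<integral>\<^sup>+X. evidence X \<partial>N) \<noteq> \<infinity>" by (simp add: prior_total)
  from nn_integral_PInf_AE[OF _ this] show ?thesis by (auto simp: less_top)
qed

text \<open>The equation also covers infinite or vanishing evidence: the Bochner integral of a function with
  infinite integral is \<open>0\<close>, so both sides are then \<open>0\<close>.\<close>
lemma ennreal_post:
  assumes "X \<in> space N" "\<xi> \<in> space M"
  shows "ennreal (post X \<xi>) = ennreal (1 / enn2real (evidence X)) * ennreal (p \<xi> X * \<pi> \<xi>)"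
proof -
  have "(\<integral>\<zeta>. p \<zeta> X * \<pi> \<zeta> \<partial>M) = enn2real (evidence X)"
    unfolding evidence_def using assms
    by (intro integral_eq_nn_integral) (auto intro!: AE_I2 likelihood_nonneg prior_nonneg mult_nonneg_nonneg)
  then show ?thesis
    using assms by (simp add: post_def likelihood_nonneg prior_nonneg flip: ennreal_mult)
qed

lemma post_nonneg: "X \<in> space N \<Longrightarrow> \<xi> \<in> space M \<Longrightarrow> 0 \<le> post X \<xi>"
  unfolding post_def
  by (intro divide_nonneg_nonneg mult_nonneg_nonneg Bochner_Integration.integral_nonneg likelihood_nonneg prior_nonneg)

lemma post_measurable [measurable (raw)]:
  assumes [measurable]: "f \<in> measurable L N" "h \<in> measurable L M"
  shows "(\<lambda>x. post (f x) (h x)) \<in> borel_measurable L"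
  unfolding post_def by measurable

definition post_mass :: "'x \<Rightarrow> 'a set \<Rightarrow> ennreal" where
  "post_mass X U = (\<integral>\<^sup>+\<xi>. ennreal (post X \<xi>) * indicator U \<xi> \<partial>M)"

lemma post_mass_eq:
  assumes [measurable]: "X \<in> space N" "U \<in> sets M"
  shows "post_mass X U = ennreal (1 / enn2real (evidence X)) * (\<integral>\<^sup>+\<xi>. ennreal (p \<xi> X * \<pi> \<xi>) * indicator U \<xi> \<partial>M)"
proof -
  have "post_mass X U = (\<integral>\<^sup>+\<xi>. ennreal (1 / enn2real (evidence X)) * (ennreal (p \<xi> X * \<pi> \<xi>) * indicator U \<xi>) \<partial>M)"
    unfolding post_mass_def by (intro nn_integral_cong) (simp add: ennreal_post assms(1) mult.assoc)
  also have "\<dots> = ennreal (1 / enn2real (evidence X)) * (\<integral>\<^sup>+\<xi>. ennreal (p \<xi> X * \<pi> \<xi>) * indicator U \<xi> \<partial>M)"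
    by (rule nn_integral_cmult) measurable
  finally show ?thesis .
qed

lemma ennreal_inverse_enn2real_mult_le: "ennreal (1 / enn2real e) * e \<le> 1"
  by (cases e) (auto simp flip: ennreal_mult simp: divide_simps)

lemma post_mass_le_1:
  assumes "X \<in> space N" "U \<in> sets M"
  shows "post_mass X U \<le> 1"
proof -
  have "post_mass X U \<le> ennreal (1 / enn2real (evidence X)) * evidence X"
    unfolding post_mass_eq[OF assms] unfolding evidence_def
    by (intro mult_left_mono nn_integral_mono) (auto simp: indicator_def)
  also have "\<dots> \<le> 1" by (rule ennreal_inverse_enn2real_mult_le)
  finally show ?thesis .
qed

lemma prob_density_post:
  assumes "X \<in> space N" "0 < evidence X" "evidence X < \<infinity>"
  shows "prob_density_on M (post X)"
proof -
  have "post_mass X (space M) = ennreal (1 / enn2real (evidence X)) * evidence X"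
    using assms(1) by (simp add: post_mass_eq evidence_def cong: nn_integral_cong)
  also have "\<dots> = 1"
    using assms(2,3) by (cases "evidence X") (auto simp flip: ennreal_mult)
  finally have "(\<integral>\<^sup>+\<xi>. ennreal (post X \<xi>) \<partial>M) = 1"
    by (simp add: post_mass_def cong: nn_integral_cong)
  then show ?thesis using assms(1) by (auto simp: prob_density_on_def post_nonneg)
qed

text \<open>The classical decomposition of the expected posterior mass of a set of bad parameters: the test
  rejects, or the evidence is small compared with the true likelihood, or else the posterior
  density is at most \<open>1 / k\<close> times prior times likelihood ratio, and Fubini turns the last part into
  the type II error of the test averaged over the prior.\<close>
lemma post_mass_tail:
  assumes \<xi>0: "\<xi>\<^sub>0 \<in> space M" and [measurable]: "U \<in> sets M" "\<phi> \<in> borel_measurable N"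
    and \<phi>: "\<And>X. 0 \<le> \<phi> X \<and> \<phi> X \<le> (1::real)" and k: "0 < k"
  shows "(\<integral>\<^sup>+X. ennreal (p \<xi>\<^sub>0 X) * post_mass X U \<partial>N) \<le>
      (\<integral>\<^sup>+X. ennreal (p \<xi>\<^sub>0 X) * ennreal (\<phi> X) \<partial>N)
    + (\<integral>\<^sup>+X. ennreal (p \<xi>\<^sub>0 X) * indicator {X\<in>space N. evidence X < ennreal (k * p \<xi>\<^sub>0 X)} X \<partial>N)
    + ennreal (1 / k) * (\<integral>\<^sup>+\<xi>. ennreal (\<pi> \<xi>) * indicator U \<xi> * (\<integral>\<^sup>+X. ennreal (p \<xi> X) * ennreal (1 - \<phi> X) \<partial>N) \<partial>M)"
    (is "?L \<le> ?A + ?B + ?C")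
proof -
  note [measurable] = measurable_const[OF \<xi>0]
  let ?J = "\<lambda>X. \<integral>\<^sup>+\<xi>. ennreal (p \<xi> X * \<pi> \<xi>) * indicator U \<xi> \<partial>M"
  let ?b = "\<lambda>X. ennreal (p \<xi>\<^sub>0 X) * indicator {X\<in>space N. evidence X < ennreal (k * p \<xi>\<^sub>0 X)} X"
  have pt: "ennreal (p \<xi>\<^sub>0 X) * post_mass X U \<le>
      ennreal (p \<xi>\<^sub>0 X) * ennreal (\<phi> X) + ?b X + ennreal (1 / k) * (ennreal (1 - \<phi> X) * ?J X)"
    if X: "X \<in> space N" for X
  proof (cases "evidence X < ennreal (k * p \<xi>\<^sub>0 X)")
    case True
    have "ennreal (p \<xi>\<^sub>0 X) * post_mass X U \<le> ennreal (p \<xi>\<^sub>0 X) * 1"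
      by (intro mult_left_mono post_mass_le_1 X) auto
    also have "\<dots> = ?b X" using True X by simp
    finally show ?thesis by (simp add: add_increasing add_increasing2)
  next
    case False
    have p0: "0 \<le> p \<xi>\<^sub>0 X" using likelihood_nonneg[OF \<xi>0 X] .
    have "ennreal (p \<xi>\<^sub>0 X) * ennreal (1 / enn2real (evidence X)) \<le> ennreal (1 / k)"
    proof (cases "evidence X")
      case (real e)
      with False p0 k have "k * p \<xi>\<^sub>0 X \<le> e" by (simp add: not_less)
      then have "p \<xi>\<^sub>0 X * (1 / e) \<le> 1 / k"
        using k p0 real by (cases "e = 0") (auto simp: field_simps)
      then show ?thesis using real p0 by (auto simp flip: ennreal_mult intro!: ennreal_leI)
    qed auto
    then have *: "ennreal (p \<xi>\<^sub>0 X) * post_mass X U \<le> ennreal (1 / k) * ?J X"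
      unfolding post_mass_eq[OF X \<open>U \<in> sets M\<close>] mult.assoc[symmetric] by (rule mult_right_mono) simp
    have "ennreal (p \<xi>\<^sub>0 X) * post_mass X U
      = (ennreal (\<phi> X) + ennreal (1 - \<phi> X)) * (ennreal (p \<xi>\<^sub>0 X) * post_mass X U)"
      using \<phi>[of X] by (simp flip: ennreal_plus)
    also have "\<dots> = ennreal (\<phi> X) * (ennreal (p \<xi>\<^sub>0 X) * post_mass X U)
        + ennreal (1 - \<phi> X) * (ennreal (p \<xi>\<^sub>0 X) * post_mass X U)"
      by (simp add: distrib_right)
    also have "\<dots> \<le> ennreal (\<phi> X) * (ennreal (p \<xi>\<^sub>0 X) * 1) + ennreal (1 - \<phi> X) * (ennreal (1 / k) * ?J X)"
      by (intro add_mono mult_left_mono * post_mass_le_1 X) auto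
    finally show ?thesis using False by (simp add: mult_ac)
  qed
  have "?L \<le> (\<integral>\<^sup>+X. ennreal (p \<xi>\<^sub>0 X) * ennreal (\<phi> X) + ?b X + ennreal (1 / k) * (ennreal (1 - \<phi> X) * ?J X) \<partial>N)"
    by (intro nn_integral_mono pt)
  also have "\<dots> = ?A + ?B + ennreal (1 / k) * (\<integral>\<^sup>+X. ennreal (1 - \<phi> X) * ?J X \<partial>N)"
    by (simp add: nn_integral_add nn_integral_cmult)
  also have "(\<integral>\<^sup>+X. ennreal (1 - \<phi> X) * ?J X \<partial>N)
    = (\<integral>\<^sup>+X. (\<integral>\<^sup>+\<xi>. ennreal (1 - \<phi> X) * (ennreal (p \<xi> X * \<pi> \<xi>) * indicator U \<xi>) \<partial>M) \<partial>N)"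
    by (intro nn_integral_cong) (simp add: nn_integral_cmult)
  also have "\<dots> = (\<integral>\<^sup>+\<xi>. (\<integral>\<^sup>+X. ennreal (1 - \<phi> X) * (ennreal (p \<xi> X * \<pi> \<xi>) * indicator U \<xi>) \<partial>N) \<partial>M)"
    by (rule Fubini') measurable
  also have "\<dots> = (\<integral>\<^sup>+\<xi>. ennreal (\<pi> \<xi>) * indicator U \<xi> * (\<integral>\<^sup>+X. ennreal (p \<xi> X) * ennreal (1 - \<phi> X) \<partial>N) \<partial>M)"
    by (intro nn_integral_cong, subst nn_integral_cmult[symmetric], measurable,
        intro nn_integral_cong) (simp add: ennreal_mult likelihood_nonneg prior_nonneg mult_ac)
  finally show ?thesis .
qed

text \<open>Points where \<open>p \<xi>\<close> vanishes are null for \<open>p \<xi>\<close>, hence by absolute continuity also for the true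
  distribution; elsewhere the two densities can be divided. This gives the abstract derivative in the
  Renyi divergence a jointly measurable form.\<close>
lemma AE_renyi_density_ratio:
  assumes \<xi>0: "\<xi>\<^sub>0 \<in> space M" and \<xi>: "\<xi> \<in> space M"
    and ac: "absolutely_continuous (dens_measure N (p \<xi>)) (dens_measure N (p \<xi>\<^sub>0))"
  shows "AE X in dens_measure N (p \<xi>\<^sub>0).
    0 < p \<xi> X \<and> RN_deriv (dens_measure N (p \<xi>)) (dens_measure N (p \<xi>\<^sub>0)) X = ennreal (p \<xi>\<^sub>0 X / p \<xi> X)"
proof -
  let ?P = "dens_measure N (p \<xi>)" and ?R = "dens_measure N (p \<xi>\<^sub>0)"
  note [measurable] = measurable_const[OF \<xi>0] measurable_const[OF \<xi>]
  have sets [measurable_cong, simp]: "sets ?P = sets N" "sets ?R = sets N" by (simp_all add: dens_measure_def)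
  interpret P: finite_measure ?P
    by standard (simp add: dens_measure_def emeasure_density likelihood_total[OF \<xi>] cong: nn_integral_cong)
  have transfer: "AE X in ?R. Q X" if "AE X in ?P. Q X" for Q
    by (rule absolutely_continuous_AE[OF _ ac that]) (simp add: sets)
  have pos: "AE X in ?P. 0 < p \<xi> X"
    unfolding dens_measure_def by (subst AE_density) auto
  have pos0: "AE X in N. 0 < p \<xi>\<^sub>0 X \<longrightarrow> 0 < p \<xi> X"
    using transfer[OF pos] unfolding dens_measure_def by (subst (asm) AE_density) auto
  have "density ?P (\<lambda>X. ennreal (p \<xi>\<^sub>0 X / p \<xi> X))
      = density N (\<lambda>X. ennreal (p \<xi> X) * ennreal (p \<xi>\<^sub>0 X / p \<xi> X))"
    unfolding dens_measure_def by (intro density_density_eq) auto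
  also have "\<dots> = ?R"
    unfolding dens_measure_def
  proof (intro density_cong)
    show "AE X in N. ennreal (p \<xi> X) * ennreal (p \<xi>\<^sub>0 X / p \<xi> X) = ennreal (p \<xi>\<^sub>0 X)"
      using pos0
    proof (rule AE_mp, intro AE_I2 impI)
      fix X assume "X \<in> space N" and *: "0 < p \<xi>\<^sub>0 X \<longrightarrow> 0 < p \<xi> X"
      then have "0 \<le> p \<xi> X" "0 \<le> p \<xi>\<^sub>0 X" using likelihood_nonneg \<xi> \<xi>0 by auto
      then show "ennreal (p \<xi> X) * ennreal (p \<xi>\<^sub>0 X / p \<xi> X) = ennreal (p \<xi>\<^sub>0 X)"
        using * by (cases "p \<xi>\<^sub>0 X = 0") (auto simp flip: ennreal_mult)
    qed
  qed measurable
  finally have eq: "density ?P (\<lambda>X. ennreal (p \<xi>\<^sub>0 X / p \<xi> X)) = ?R" .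
  have "AE X in ?P. ennreal (p \<xi>\<^sub>0 X / p \<xi> X) = RN_deriv ?P ?R X"
    by (rule P.RN_deriv_unique[OF _ eq]) measurable
  with pos have "AE X in ?P. 0 < p \<xi> X \<and> RN_deriv ?P ?R X = ennreal (p \<xi>\<^sub>0 X / p \<xi> X)" by auto
  then show ?thesis by (rule transfer)
qed

text \<open>The value \<open>\<infinity>\<close> where \<open>p \<xi>\<close> vanishes keeps the tangent inequality valid at every data point.\<close>
definition ratio_power :: "real \<Rightarrow> 'a \<Rightarrow> 'a \<Rightarrow> 'x \<Rightarrow> ennreal" where
  "ratio_power l \<xi>\<^sub>0 \<xi> X = (if p \<xi> X = 0 then \<infinity> else ennreal ((p \<xi>\<^sub>0 X / p \<xi> X) powr l))"

lemma ratio_power_integral_le: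
  assumes \<xi>0: "\<xi>\<^sub>0 \<in> space M" and \<xi>: "\<xi> \<in> space M" and l: "0 < l"
    and renyi: "renyi_divergence l (dens_measure N (p \<xi>\<^sub>0)) (dens_measure N (p \<xi>)) \<le> ereal r"
  shows "(\<integral>\<^sup>+X. ennreal (p \<xi>\<^sub>0 X) * ratio_power l \<xi>\<^sub>0 \<xi> X \<partial>N) \<le> ennreal (exp (l * r))"
proof -
  let ?P = "dens_measure N (p \<xi>)" and ?R = "dens_measure N (p \<xi>\<^sub>0)"
  note [measurable] = measurable_const[OF \<xi>0] measurable_const[OF \<xi>]
  define I where "I = (\<integral>\<^sup>+X. ennreal (enn2real (RN_deriv ?P ?R X) powr l) \<partial>?R)"
  have ac: "absolutely_continuous ?P ?R" and fin: "I < \<infinity>" and le: "1 / l * ln (enn2real I) \<le> r"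
    using renyi by (auto simp: renyi_divergence_def I_def[symmetric] Let_def split: if_splits)
  have "(\<integral>\<^sup>+X. ennreal (p \<xi>\<^sub>0 X) * ratio_power l \<xi>\<^sub>0 \<xi> X \<partial>N) = (\<integral>\<^sup>+X. ratio_power l \<xi>\<^sub>0 \<xi> X \<partial>?R)"
    unfolding dens_measure_def ratio_power_def by (subst nn_integral_density) auto
  also have "\<dots> = I"
    unfolding I_def
  proof (rule nn_integral_cong_AE)
    have nn: "AE X in ?R. 0 \<le> p \<xi>\<^sub>0 X"
      by (rule AE_I2) (simp add: dens_measure_def likelihood_nonneg \<xi>0)
    show "AE X in ?R. ratio_power l \<xi>\<^sub>0 \<xi> X = ennreal (enn2real (RN_deriv ?P ?R X) powr l)"
      using AE_renyi_density_ratio[OF \<xi>0 \<xi> ac] nn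
      by eventually_elim (auto simp: ratio_power_def)
  qed
  also have "I \<le> ennreal (exp (l * r))"
  proof (cases I)
    case (real i)
    show ?thesis
    proof (cases "i = 0")
      case False
      then have "ln i \<le> l * r" using le real l by (simp add: field_simps)
      then have "exp (ln i) \<le> exp (l * r)" by simp
      then have "i \<le> exp (l * r)" using False real by simp
      then show ?thesis using real by (simp add: ennreal_leI)
    qed (simp add: real)
  qed (use fin in simp)
  finally show ?thesis .
qed

text \<open>The evidence dominates the integral of prior times likelihood over \<open>A\<close>. If the average likelihood
  ratio \<open>y = p \<xi> / p \<xi>\<^sub>0\<close> over \<open>A\<close> is below \<open>t\<close>, then by convexity the average of \<open>y powr - l\<close>
  over \<open>A\<close> is at least \<open>t powr - l\<close>; the expectation of that average under the true distribution is
  the exponential moment that the Renyi divergence controls, so Markov's inequality applies.\<close>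
lemma evidence_lower_tail:
  assumes \<xi>0: "\<xi>\<^sub>0 \<in> space M" and A: "A \<subseteq> space M" and \<rho>: "0 < \<rho>" "\<rho> \<le> measure (dens_measure M \<pi>) A"
    and l: "0 < l" and t: "0 < t"
    and renyi: "\<And>\<xi>. \<xi> \<in> A \<Longrightarrow>
      renyi_divergence l (dens_measure N (p \<xi>\<^sub>0)) (dens_measure N (p \<xi>)) \<le> ereal r"
  shows "(\<integral>\<^sup>+X. ennreal (p \<xi>\<^sub>0 X) * indicator {X\<in>space N. evidence X < ennreal (t * \<rho> * p \<xi>\<^sub>0 X)} X \<partial>N)
    \<le> ennreal (t powr l * exp (l * r))"
proof -
  define m where "m = measure (dens_measure M \<pi>) A"
  have m: "0 < m" "\<rho> \<le> m" using \<rho> by (simp_all add: m_def)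
  \<comment> \<open>A set outside the sigma-algebra has measure \<open>0\<close>, so positive mass forces measurability.\<close>
  have "A \<in> sets (dens_measure M \<pi>)"
    using m(1) measure_notin_sets by (fastforce simp: m_def)
  then have [measurable]: "A \<in> sets M" by (simp add: dens_measure_def)
  note [measurable] = measurable_const[OF \<xi>0]
  have [measurable]: "(\<lambda>(\<xi>, X). ratio_power l \<xi>\<^sub>0 \<xi> X) \<in> borel_measurable (M \<Otimes>\<^sub>M N)"
    unfolding ratio_power_def by measurable
  have prior_A: "(\<integral>\<^sup>+\<xi>. ennreal (\<pi> \<xi>) * indicator A \<xi> \<partial>M) = ennreal m"
    using emeasure_prior[of A] emeasure_prior_eq[of A] by (simp add: m_def)
  let ?V = "\<lambda>X. \<integral>\<^sup>+\<xi>. ennreal (\<pi> \<xi>) * indicator A \<xi> * ratio_power l \<xi>\<^sub>0 \<xi> X \<partial>M"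
  have V: "ennreal (t powr - l * m) \<le> ?V X"
    if X: "X \<in> space N" and p0: "0 < p \<xi>\<^sub>0 X" and ev: "evidence X < ennreal (t * \<rho> * p \<xi>\<^sub>0 X)" for X
  proof -
    \<comment> \<open>Up to sign, the slope of the tangent at \<open>t\<close> as a function of \<open>p \<xi> X\<close>.\<close>
    define c where "c = l * t powr (- l - 1) / p \<xi>\<^sub>0 X"
    have c: "0 \<le> c" using l p0 by (simp add: c_def)
    have "ennreal ((1 + l) * t powr - l) \<le> ratio_power l \<xi>\<^sub>0 \<xi> X + ennreal c * ennreal (p \<xi> X)" if "\<xi> \<in> space M" for \<xi>
    proof (cases "p \<xi> X = 0")
      case False
      then have pos: "0 < p \<xi> X" using likelihood_nonneg[OF that X] by simp
      have "(1 + l) * t powr - l \<le> (p \<xi> X / p \<xi>\<^sub>0 X) powr - l + l * t powr (- l - 1) * (p \<xi> X / p \<xi>\<^sub>0 X)"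
        using pos p0 by (intro tangent_inequality l t) auto
      also have "(p \<xi> X / p \<xi>\<^sub>0 X) powr - l = (p \<xi>\<^sub>0 X / p \<xi> X) powr l"
        using pos p0 by (simp add: powr_minus powr_divide)
      also have "l * t powr (- l - 1) * (p \<xi> X / p \<xi>\<^sub>0 X) = c * p \<xi> X" by (simp add: c_def)
      finally have "ennreal ((1 + l) * t powr - l) \<le> ennreal ((p \<xi>\<^sub>0 X / p \<xi> X) powr l + c * p \<xi> X)"
        by (rule ennreal_leI)
      then show ?thesis
        using pos c by (simp add: ratio_power_def ennreal_mult)
    qed (simp add: ratio_power_def)
    then have "(\<integral>\<^sup>+\<xi>. ennreal ((1 + l) * t powr - l) * (ennreal (\<pi> \<xi>) * indicator A \<xi>) \<partial>M)
      \<le> (\<integral>\<^sup>+\<xi>. (ratio_power l \<xi>\<^sub>0 \<xi> X + ennreal c * ennreal (p \<xi> X)) * (ennreal (\<pi> \<xi>) * indicator A \<xi>) \<partial>M)"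
      by (intro nn_integral_mono mult_right_mono) auto
    also have "\<dots> = (\<integral>\<^sup>+\<xi>. ennreal (\<pi> \<xi>) * indicator A \<xi> * ratio_power l \<xi>\<^sub>0 \<xi> X
        + ennreal c * (ennreal (p \<xi> X * \<pi> \<xi>) * indicator A \<xi>) \<partial>M)"
      using X by (intro nn_integral_cong)
        (simp add: distrib_left mult_ac ennreal_mult likelihood_nonneg prior_nonneg)
    also have "\<dots> = ?V X + ennreal c * (\<integral>\<^sup>+\<xi>. ennreal (p \<xi> X * \<pi> \<xi>) * indicator A \<xi> \<partial>M)"
      using X by (simp add: nn_integral_add nn_integral_cmult)
    also have "\<dots> \<le> ?V X + ennreal c * evidence X"
      unfolding evidence_def
      by (intro add_mono mult_left_mono nn_integral_mono) (auto simp: indicator_def)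
    also have "\<dots> \<le> ?V X + ennreal c * ennreal (t * m * p \<xi>\<^sub>0 X)"
    proof (intro add_mono mult_left_mono order.refl)
      have "t * \<rho> * p \<xi>\<^sub>0 X \<le> t * m * p \<xi>\<^sub>0 X"
        using m t p0 by (intro mult_right_mono mult_left_mono) auto
      then show "evidence X \<le> ennreal (t * m * p \<xi>\<^sub>0 X)"
        using ev by (metis ennreal_leI less_imp_le order.trans)
    qed simp
    also have "ennreal c * ennreal (t * m * p \<xi>\<^sub>0 X) = ennreal (l * t powr - l * m)"
      using c p0 t m by (simp add: c_def powr_diff mult.assoc flip: ennreal_mult)
    finally have "ennreal ((1 + l) * t powr - l) * ennreal m \<le> ?V X + ennreal (l * t powr - l * m)"
      by (simp add: nn_integral_cmult prior_A)
    also have "ennreal ((1 + l) * t powr - l) * ennreal m = ennreal (t powr - l * m) + ennreal (l * t powr - l * m)"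
      using l m by (simp add: algebra_simps flip: ennreal_mult ennreal_plus)
    finally show ?thesis by simp
  qed
  have "(\<integral>\<^sup>+X. ennreal (p \<xi>\<^sub>0 X) * indicator {X\<in>space N. evidence X < ennreal (t * \<rho> * p \<xi>\<^sub>0 X)} X \<partial>N)
    \<le> (\<integral>\<^sup>+X. ennreal (t powr l / m) * (ennreal (p \<xi>\<^sub>0 X) * ?V X) \<partial>N)"
  proof (intro nn_integral_mono)
    fix X assume X: "X \<in> space N"
    show "ennreal (p \<xi>\<^sub>0 X) * indicator {X\<in>space N. evidence X < ennreal (t * \<rho> * p \<xi>\<^sub>0 X)} X
      \<le> ennreal (t powr l / m) * (ennreal (p \<xi>\<^sub>0 X) * ?V X)"
    proof (cases "evidence X < ennreal (t * \<rho> * p \<xi>\<^sub>0 X) \<and> 0 < p \<xi>\<^sub>0 X")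
      case True
      have "ennreal (p \<xi>\<^sub>0 X) = ennreal (t powr l / m) * (ennreal (p \<xi>\<^sub>0 X) * ennreal (t powr - l * m))"
        using True t m by (simp add: powr_minus field_simps flip: ennreal_mult)
      also have "\<dots> \<le> ennreal (t powr l / m) * (ennreal (p \<xi>\<^sub>0 X) * ?V X)"
        using V[OF X] True by (intro mult_left_mono) auto
      finally show ?thesis using True X by simp
    qed (auto simp: ennreal_neg)
  qed
  also have "\<dots> = ennreal (t powr l / m) *
      (\<integral>\<^sup>+X. (\<integral>\<^sup>+\<xi>. ennreal (p \<xi>\<^sub>0 X) * (ennreal (\<pi> \<xi>) * indicator A \<xi> * ratio_power l \<xi>\<^sub>0 \<xi> X) \<partial>M) \<partial>N)"
    by (simp add: nn_integral_cmult cong: nn_integral_cong_simp)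
  also have "(\<integral>\<^sup>+X. (\<integral>\<^sup>+\<xi>. ennreal (p \<xi>\<^sub>0 X) * (ennreal (\<pi> \<xi>) * indicator A \<xi> * ratio_power l \<xi>\<^sub>0 \<xi> X) \<partial>M) \<partial>N)
    = (\<integral>\<^sup>+\<xi>. (\<integral>\<^sup>+X. ennreal (p \<xi>\<^sub>0 X) * (ennreal (\<pi> \<xi>) * indicator A \<xi> * ratio_power l \<xi>\<^sub>0 \<xi> X) \<partial>N) \<partial>M)"
    by (rule Fubini') measurable
  also have "\<dots> \<le> (\<integral>\<^sup>+\<xi>. ennreal (\<pi> \<xi>) * indicator A \<xi> * ennreal (exp (l * r)) \<partial>M)"
  proof (intro nn_integral_mono)
    fix \<xi> assume \<xi>: "\<xi> \<in> space M"
    have "(\<integral>\<^sup>+X. ennreal (p \<xi>\<^sub>0 X) * (ennreal (\<pi> \<xi>) * indicator A \<xi> * ratio_power l \<xi>\<^sub>0 \<xi> X) \<partial>N)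
      = (\<integral>\<^sup>+X. ennreal (\<pi> \<xi>) * indicator A \<xi> * (ennreal (p \<xi>\<^sub>0 X) * ratio_power l \<xi>\<^sub>0 \<xi> X) \<partial>N)"
      by (simp add: mult_ac)
    also have "\<dots> = ennreal (\<pi> \<xi>) * indicator A \<xi> * (\<integral>\<^sup>+X. ennreal (p \<xi>\<^sub>0 X) * ratio_power l \<xi>\<^sub>0 \<xi> X \<partial>N)"
      using \<xi> by (intro nn_integral_cmult) measurable
    also have "\<dots> \<le> ennreal (\<pi> \<xi>) * indicator A \<xi> * ennreal (exp (l * r))"
      using ratio_power_integral_le[OF \<xi>0 \<xi> l renyi]
      by (cases "\<xi> \<in> A") (auto intro!: mult_left_mono)
    finally show "(\<integral>\<^sup>+X. ennreal (p \<xi>\<^sub>0 X) * (ennreal (\<pi> \<xi>) * indicator A \<xi> * ratio_power l \<xi>\<^sub>0 \<xi> X) \<partial>N)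
      \<le> ennreal (\<pi> \<xi>) * indicator A \<xi> * ennreal (exp (l * r))" .
  qed
  also have "\<dots> = ennreal m * ennreal (exp (l * r))"
    by (simp add: nn_integral_multc prior_A)
  also have "ennreal (t powr l / m) * (ennreal m * ennreal (exp (l * r))) = ennreal (t powr l * exp (l * r))"
    using m by (simp flip: ennreal_mult)
  finally show ?thesis by (simp add: mult_left_mono)
qed

end

section \<open>Exponential moments of the loss under the posterior\<close>

text \<open>A measurable stand-in for an exponential moment of the loss: if the loss exceeds level \<open>j\<close> only on
  \<open>U j\<close>, then \<open>exp (s * loss)\<close> is at most this layered sum up to a constant factor. The loss is a
  supremum over an uncountable set, so its own measurability is best avoided.\<close>
definition tail_weight :: "real \<Rightarrow> (nat \<Rightarrow> 'a set) \<Rightarrow> 'a \<Rightarrow> ennreal" where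
  "tail_weight s U \<xi> = 1 + (\<Sum>j. ennreal (exp (s * (real j + 1))) * indicator (U j) \<xi>)"

lemma tail_weight_ge_1: "1 \<le> tail_weight s U \<xi>"
  by (simp add: tail_weight_def)

lemma tail_weight_ge_exp:
  assumes "\<xi> \<in> U j" shows "ennreal (exp (s * (real j + 1))) \<le> tail_weight s U \<xi>"
proof -
  define F where "F = (\<lambda>j. ennreal (exp (s * (real j + 1))) * indicator (U j) \<xi>)"
  have "sum F {j} \<le> suminf F" by (rule sum_le_suminf) auto
  then have "F j \<le> 1 + suminf F" by (simp add: add_increasing)
  then show ?thesis using assms by (simp add: tail_weight_def F_def)
qed

text \<open>If the loss were larger, with \<open>y = log W / s\<close> the point would lie in \<open>U j\<close> for \<open>j = \<lfloor>y\<rfloor>\<close>, which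
  forces \<open>W \<ge> exp (s (j + 1))\<close>, that is \<open>y \<ge> j + 1\<close>.\<close>
lemma loss_le_ln_tail_weight:
  assumes s: "0 < s" and c: "0 < c" and a: "0 \<le> a"
    and U: "\<And>j. ennreal (c * (a + real j + 1)) \<le> L \<Longrightarrow> \<xi> \<in> U j"
  shows "L \<le> ennreal (c * (a + 1)) + ennreal (c / s) * ln_ennreal (tail_weight s U \<xi>)"
proof (cases "tail_weight s U \<xi>")
  case (real w)
  have w: "1 \<le> w" using tail_weight_ge_1[of s U \<xi>] real by (simp flip: ennreal_1)
  define y where "y = ln w / s"
  have y: "0 \<le> y" using w s by (simp add: y_def)
  have "L \<le> ennreal (c * (a + 1) + c * y)"
  proof (rule ccontr)
    assume "\<not> ?thesis"
    then have big: "ennreal (c * (a + 1) + c * y) \<le> L" by simp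
    define j where "j = nat \<lfloor>y\<rfloor>"
    have j: "real j \<le> y" "y < real j + 1" using y by (auto simp: j_def)
    have "c * (a + real j + 1) \<le> c * (a + 1) + c * y"
      using j c by (simp add: algebra_simps)
    then have "ennreal (c * (a + real j + 1)) \<le> L"
      using big by (meson ennreal_leI order.trans)
    then have "ennreal (exp (s * (real j + 1))) \<le> tail_weight s U \<xi>"
      by (intro tail_weight_ge_exp U)
    then have "exp (s * (real j + 1)) \<le> w" using w by (simp add: real)
    then have "s * (real j + 1) \<le> ln w" using w by (simp add: ln_ge_iff)
    then have "real j + 1 \<le> y" using s by (simp add: y_def field_simps)
    then show False using j by simp
  qed
  also have "\<dots> = ennreal (c * (a + 1)) + ennreal (c / s) * ln_ennreal (tail_weight s U \<xi>)"
    using w s c a y by (simp add: real ln_ennreal_def y_def flip: ennreal_mult)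
  finally show ?thesis .
next
  case top
  then show ?thesis using c s by (simp add: ln_ennreal_def ennreal_mult_top)
qed

context dominated_model begin

text \<open>The posterior mass of \<open>U j\<close> decays at rate \<open>2 s\<close> while the weights grow at rate \<open>s\<close>, which leaves
  the geometric series \<open>\<Sum>j. exp (- s (j + 1)) = 1 / (exp s - 1)\<close>.\<close>
lemma expected_tail_weight_le:
  assumes \<xi>0: "\<xi>\<^sub>0 \<in> space M" and [measurable]: "\<And>j. U j \<in> sets M" and s: "0 < s" and K: "0 \<le> K"
    and tail: "\<And>j. (\<integral>\<^sup>+X. ennreal (p \<xi>\<^sub>0 X) * post_mass X (U j) \<partial>N) \<le> ennreal (K * exp (- (2 * s) * (real j + 1)))"
  shows "(\<integral>\<^sup>+X. ennreal (p \<xi>\<^sub>0 X) * (\<integral>\<^sup>+\<xi>. ennreal (post X \<xi>) * tail_weight s U \<xi> \<partial>M) \<partial>N) \<le> ennreal (1 + K / (exp s - 1))"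
proof -
  note [measurable] = measurable_const[OF \<xi>0]
  let ?e = "\<lambda>j. ennreal (exp (s * (real j + 1)))"
  have [measurable]: "(\<lambda>X. post_mass X V) \<in> borel_measurable N" if [measurable]: "V \<in> sets M" for V
    unfolding post_mass_def by measurable
  have inner: "(\<integral>\<^sup>+\<xi>. ennreal (post X \<xi>) * tail_weight s U \<xi> \<partial>M) = post_mass X (space M) + (\<Sum>j. ?e j * post_mass X (U j))"
    if X [simp]: "X \<in> space N" for X
  proof -
    have "(\<integral>\<^sup>+\<xi>. ennreal (post X \<xi>) * tail_weight s U \<xi> \<partial>M)
      = (\<integral>\<^sup>+\<xi>. ennreal (post X \<xi>) * indicator (space M) \<xi> + (\<Sum>j. ?e j * (ennreal (post X \<xi>) * indicator (U j) \<xi>)) \<partial>M)"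
      by (intro nn_integral_cong)
        (simp add: tail_weight_def distrib_left mult_ac flip: ennreal_suminf_cmult)
    also have "\<dots> = post_mass X (space M) + (\<Sum>j. (\<integral>\<^sup>+\<xi>. ?e j * (ennreal (post X \<xi>) * indicator (U j) \<xi>) \<partial>M))"
      unfolding post_mass_def by (subst nn_integral_add) (simp_all add: nn_integral_suminf)
    also have "(\<lambda>j. (\<integral>\<^sup>+\<xi>. ?e j * (ennreal (post X \<xi>) * indicator (U j) \<xi>) \<partial>M)) = (\<lambda>j. ?e j * post_mass X (U j))"
      unfolding post_mass_def by (rule ext, rule nn_integral_cmult) measurable
    finally show ?thesis .
  qed
  have "(\<integral>\<^sup>+X. ennreal (p \<xi>\<^sub>0 X) * (\<integral>\<^sup>+\<xi>. ennreal (post X \<xi>) * tail_weight s U \<xi> \<partial>M) \<partial>N)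
    \<le> (\<integral>\<^sup>+X. ennreal (p \<xi>\<^sub>0 X) + (\<Sum>j. ?e j * (ennreal (p \<xi>\<^sub>0 X) * post_mass X (U j))) \<partial>N)"
  proof (intro nn_integral_mono)
    fix X assume X: "X \<in> space N"
    have "ennreal (p \<xi>\<^sub>0 X) * post_mass X (space M) \<le> ennreal (p \<xi>\<^sub>0 X) * 1"
      by (intro mult_left_mono post_mass_le_1 X) auto
    moreover have "ennreal (p \<xi>\<^sub>0 X) * (\<Sum>j. ?e j * post_mass X (U j)) = (\<Sum>j. ?e j * (ennreal (p \<xi>\<^sub>0 X) * post_mass X (U j)))"
      by (subst ennreal_suminf_cmult[symmetric]) (simp only: mult.left_commute)
    ultimately show "ennreal (p \<xi>\<^sub>0 X) * (\<integral>\<^sup>+\<xi>. ennreal (post X \<xi>) * tail_weight s U \<xi> \<partial>M)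
      \<le> ennreal (p \<xi>\<^sub>0 X) + (\<Sum>j. ?e j * (ennreal (p \<xi>\<^sub>0 X) * post_mass X (U j)))"
      by (simp only: inner[OF X] distrib_left mult_1_right add_right_mono)
  qed
  also have "\<dots> = 1 + (\<Sum>j. ?e j * (\<integral>\<^sup>+X. ennreal (p \<xi>\<^sub>0 X) * post_mass X (U j) \<partial>N))"
    by (simp add: nn_integral_add nn_integral_suminf nn_integral_cmult likelihood_total[OF \<xi>0])
  also have "\<dots> \<le> 1 + (\<Sum>j. ?e j * ennreal (K * exp (- (2 * s) * (real j + 1))))"
    by (intro add_left_mono suminf_le mult_left_mono tail) auto
  also have "(\<lambda>j. ?e j * ennreal (K * exp (- (2 * s) * (real j + 1)))) = (\<lambda>j. ennreal (K * exp (- s) * exp (- s) ^ j))"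
  proof
    fix j
    have "exp (s * (real j + 1)) * exp (- (2 * s) * (real j + 1)) = exp (- s) * exp (- s) ^ j"
      unfolding exp_of_nat_mult[symmetric] mult_exp_exp by (simp add: algebra_simps)
    then show "?e j * ennreal (K * exp (- (2 * s) * (real j + 1))) = ennreal (K * exp (- s) * exp (- s) ^ j)"
      using K by (simp add: mult_ac flip: ennreal_mult)
  qed
  also have "(\<Sum>j. ennreal (K * exp (- s) * exp (- s) ^ j)) = ennreal (K * exp (- s) * (1 / (1 - exp (- s))))"
    using s K by (intro suminf_ennreal_eq sums_mult geometric_sums) auto
  also have "K * exp (- s) * (1 / (1 - exp (- s))) = K / (exp s - 1)"
    using s by (simp add: exp_minus field_simps)
  also have "1 + ennreal (K / (exp s - 1)) = ennreal (1 + K / (exp s - 1))"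
    using s K by simp
  finally show ?thesis .
qed

text \<open>Zero evidence lies below every positive threshold \<open>t\<close>, so its probability is at most a multiple of
  \<open>t powr l\<close> for all \<open>t > 0\<close>.\<close>
lemma AE_evidence_pos:
  assumes \<xi>0: "\<xi>\<^sub>0 \<in> space M" and A: "A \<subseteq> space M" and \<rho>: "0 < measure (dens_measure M \<pi>) A" and l: "0 < l"
    and renyi: "\<And>\<xi>. \<xi> \<in> A \<Longrightarrow>
      renyi_divergence l (dens_measure N (p \<xi>\<^sub>0)) (dens_measure N (p \<xi>)) \<le> ereal r"
  shows "AE X in dens_measure N (p \<xi>\<^sub>0). 0 < evidence X"
proof -
  note [measurable] = measurable_const[OF \<xi>0]
  let ?\<rho> = "measure (dens_measure M \<pi>) A"
  define z where "z = (\<integral>\<^sup>+X. ennreal (p \<xi>\<^sub>0 X) * indicator {X\<in>space N. evidence X = 0} X \<partial>N)"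
  have le: "z \<le> ennreal (t powr l * exp (l * r))" if t: "0 < t" for t
  proof -
    have "z \<le> (\<integral>\<^sup>+X. ennreal (p \<xi>\<^sub>0 X) * indicator {X\<in>space N. evidence X < ennreal (t * ?\<rho> * p \<xi>\<^sub>0 X)} X \<partial>N)"
      unfolding z_def
    proof (intro nn_integral_mono)
      fix X assume X: "X \<in> space N"
      show "ennreal (p \<xi>\<^sub>0 X) * indicator {X\<in>space N. evidence X = 0} X
        \<le> ennreal (p \<xi>\<^sub>0 X) * indicator {X\<in>space N. evidence X < ennreal (t * ?\<rho> * p \<xi>\<^sub>0 X)} X"
        using t \<rho> by (cases "0 < p \<xi>\<^sub>0 X") (auto simp: indicator_def ennreal_neg)
    qed
    also have "\<dots> \<le> ennreal (t powr l * exp (l * r))"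
      by (rule evidence_lower_tail[OF \<xi>0 A \<rho> order.refl l t renyi])
    finally show ?thesis .
  qed
  have "z \<le> ennreal x" if x: "0 < x" for x
  proof -
    have "((x / exp (l * r)) powr (1 / l)) powr l * exp (l * r) = x"
      using x l by (simp add: powr_powr)
    then show ?thesis using le[of "(x / exp (l * r)) powr (1 / l)"] x by simp
  qed
  then have "z \<le> 0" by (metis ennreal_approx_unit ennreal_le_epsilon add_0 zero_le)
  then have "AE X in N. ennreal (p \<xi>\<^sub>0 X) * indicator {X\<in>space N. evidence X = 0} X = 0"
    unfolding z_def by (subst (asm) le_zero_eq, subst (asm) nn_integral_0_iff_AE) auto
  then have "AE X in N. 0 < ennreal (p \<xi>\<^sub>0 X) \<longrightarrow> 0 < evidence X"
    using AE_space by eventually_elim (auto simp: indicator_def zero_less_iff_neq_zero)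
  moreover have "(AE X in dens_measure N (p \<xi>\<^sub>0). 0 < evidence X) = (AE X in N. 0 < ennreal (p \<xi>\<^sub>0 X) \<longrightarrow> 0 < evidence X)"
    unfolding dens_measure_def by (rule AE_density) simp
  ultimately show ?thesis by blast
qed

text \<open>Tests and sieves are used at the levels \<open>u = a + j + 1\<close>. The set of parameters with
  loss at least \<open>C1 * u\<close> is enlarged to the measurable set on which either the sieve is left or the
  type II error is small. Each contribution to its expected posterior mass
  decays at least like \<open>exp (- 2 s u)\<close>, where \<open>2 s = min C (min l 1)\<close>: the type I error at rate
  \<open>C\<close>, small evidence at rate \<open>l\<close>, and the remaining part at rate \<open>C - (C2 + C3 + 1) > 1\<close>.\<close>
lemma posterior_loss_majorant:
  assumes \<xi>0: "\<xi>\<^sub>0 \<in> space M" and a: "0 \<le> a"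
    and const: "0 < C" "0 < C0" "0 < C1" "0 < C2" "0 < C3" "0 < l" "C2 + C3 + 2 < C"
    and s: "s = min C (min l 1) / 2"
    and A: "A \<subseteq> space M" and prior_A: "exp (- C2 * a) \<le> measure (dens_measure M \<pi>) A"
    and renyi: "\<And>\<xi>. \<xi> \<in> A \<Longrightarrow>
      renyi_divergence l (dens_measure N (p \<xi>\<^sub>0)) (dens_measure N (p \<xi>)) \<le> ereal (C3 * a)"
    and test: "\<And>u. a < u \<Longrightarrow> \<exists>S\<in>sets M. \<exists>\<phi>\<in>borel_measurable N. (\<forall>X. 0 \<le> \<phi> X \<and> \<phi> X \<le> (1::real)) \<and>
      (\<integral>\<^sup>+X. ennreal (p \<xi>\<^sub>0 X) * ennreal (\<phi> X) \<partial>N) \<le> ennreal (C0 * exp (- C * u)) \<and>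
      (\<forall>\<xi>\<in>S. ennreal (C1 * u) \<le> L \<xi> \<longrightarrow>
        (\<integral>\<^sup>+X. ennreal (p \<xi> X) * ennreal (1 - \<phi> X) \<partial>N) \<le> ennreal (exp (- C * u))) \<and>
      measure (dens_measure M \<pi>) (space M - S) \<le> exp (- C * u)"
  shows "\<exists>W\<in>borel_measurable M. (\<forall>\<xi>. 1 \<le> W \<xi>) \<and>
    (\<forall>\<xi>\<in>space M. L \<xi> \<le> ennreal (C1 * (a + 1)) + ennreal (C1 / s) * ln_ennreal (W \<xi>)) \<and>
    (\<integral>\<^sup>+X. ennreal (p \<xi>\<^sub>0 X) * (\<integral>\<^sup>+\<xi>. ennreal (post X \<xi>) * W \<xi> \<partial>M) \<partial>N) \<le> ennreal (1 + (C0 + 3) / (exp s - 1))"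
proof -
  have s_pos: "0 < s" and s2: "2 * s \<le> C" "2 * s \<le> l" "2 * s \<le> 1" using const s by auto
  have sets_exist: "\<exists>U. U \<in> sets M \<and> (\<forall>\<xi>\<in>space M. ennreal (C1 * (a + real j + 1)) \<le> L \<xi> \<longrightarrow> \<xi> \<in> U) \<and>
      (\<integral>\<^sup>+X. ennreal (p \<xi>\<^sub>0 X) * post_mass X U \<partial>N) \<le> ennreal ((C0 + 3) * exp (- (2 * s) * (real j + 1)))" for j
  proof -
    define u where "u = a + real j + 1"
    have u: "a < u" "0 < u" using a by (auto simp: u_def)
    obtain S \<phi> where S [measurable]: "S \<in> sets M" and \<phi> [measurable]: "\<phi> \<in> borel_measurable N"
      and \<phi>01': "\<forall>X. 0 \<le> \<phi> X \<and> \<phi> X \<le> (1::real)"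
      and typeI: "(\<integral>\<^sup>+X. ennreal (p \<xi>\<^sub>0 X) * ennreal (\<phi> X) \<partial>N) \<le> ennreal (C0 * exp (- C * u))"
      and typeII: "\<forall>\<xi>\<in>S. ennreal (C1 * u) \<le> L \<xi> \<longrightarrow>
        (\<integral>\<^sup>+X. ennreal (p \<xi> X) * ennreal (1 - \<phi> X) \<partial>N) \<le> ennreal (exp (- C * u))"
      and sieve: "measure (dens_measure M \<pi>) (space M - S) \<le> exp (- C * u)"
      using test[OF u(1)] by (elim bexE conjE)
    have \<phi>01: "0 \<le> \<phi> X \<and> \<phi> X \<le> 1" for X using \<phi>01' by blast
    let ?\<beta> = "\<lambda>\<xi>. \<integral>\<^sup>+X. ennreal (p \<xi> X) * ennreal (1 - \<phi> X) \<partial>N"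
    \<comment> \<open>The type II error is measurable in \<open>\<xi>\<close> by Fubini.\<close>
    define U where "U = {\<xi>\<in>space M. \<xi> \<in> S \<longrightarrow> ?\<beta> \<xi> \<le> ennreal (exp (- C * u))}"
    have [measurable]: "U \<in> sets M" unfolding U_def by measurable
    \<comment> \<open>The exponent \<open>C3\<close> in \<open>t\<close> pays for the Renyi moment \<open>exp (l * C3 * a)\<close>, and the extra \<open>1\<close> leaves the decay \<open>exp (- l * u)\<close>.\<close>
    define t where "t = exp (- (C3 + 1) * u)"
    define \<rho> where "\<rho> = exp (- C2 * u)"
    have pos: "0 < t" "0 < \<rho>" by (simp_all add: t_def \<rho>_def)
    have "\<rho> \<le> exp (- C2 * a)" using u const by (simp add: \<rho>_def)
    then have \<rho>: "\<rho> \<le> measure (dens_measure M \<pi>) A" using prior_A by simp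
    have "(\<integral>\<^sup>+X. ennreal (p \<xi>\<^sub>0 X) * post_mass X U \<partial>N)
      \<le> (\<integral>\<^sup>+X. ennreal (p \<xi>\<^sub>0 X) * ennreal (\<phi> X) \<partial>N)
      + (\<integral>\<^sup>+X. ennreal (p \<xi>\<^sub>0 X) * indicator {X\<in>space N. evidence X < ennreal (t * \<rho> * p \<xi>\<^sub>0 X)} X \<partial>N)
      + ennreal (1 / (t * \<rho>)) * (\<integral>\<^sup>+\<xi>. ennreal (\<pi> \<xi>) * indicator U \<xi> * ?\<beta> \<xi> \<partial>M)"
      by (rule post_mass_tail[OF \<xi>0 _ _ \<phi>01]) (simp_all add: pos)
    also have "\<dots> \<le> ennreal (C0 * exp (- C * u)) + ennreal (t powr l * exp (l * (C3 * a)))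
      + ennreal (1 / (t * \<rho>)) * ennreal (2 * exp (- C * u))"
    proof (intro add_mono mult_left_mono typeI)
      show "(\<integral>\<^sup>+X. ennreal (p \<xi>\<^sub>0 X) * indicator {X\<in>space N. evidence X < ennreal (t * \<rho> * p \<xi>\<^sub>0 X)} X \<partial>N)
        \<le> ennreal (t powr l * exp (l * (C3 * a)))"
        by (rule evidence_lower_tail[OF \<xi>0 A pos(2) \<rho> const(6) pos(1) renyi])
      have "(\<integral>\<^sup>+\<xi>. ennreal (\<pi> \<xi>) * indicator U \<xi> * ?\<beta> \<xi> \<partial>M)
        \<le> (\<integral>\<^sup>+\<xi>. ennreal (\<pi> \<xi>) * indicator (space M - S) \<xi> + ennreal (\<pi> \<xi>) * ennreal (exp (- C * u)) \<partial>M)"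
      proof (intro nn_integral_mono)
        fix \<xi> assume \<xi>: "\<xi> \<in> space M"
        have "?\<beta> \<xi> \<le> (\<integral>\<^sup>+X. ennreal (p \<xi> X) * 1 \<partial>N)"
          using \<phi>01 by (intro nn_integral_mono mult_left_mono) (auto simp flip: ennreal_1)
        then have "?\<beta> \<xi> \<le> 1" using likelihood_total[OF \<xi>] by simp
        then have "ennreal (\<pi> \<xi>) * ?\<beta> \<xi> \<le> ennreal (\<pi> \<xi>)"
          using mult_left_mono[of "?\<beta> \<xi>" 1 "ennreal (\<pi> \<xi>)"] by simp
        then show "ennreal (\<pi> \<xi>) * indicator U \<xi> * ?\<beta> \<xi>
          \<le> ennreal (\<pi> \<xi>) * indicator (space M - S) \<xi> + ennreal (\<pi> \<xi>) * ennreal (exp (- C * u))"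
          using \<xi> by (cases "\<xi> \<in> S")
            (auto simp: U_def indicator_def intro!: mult_left_mono intro: add_increasing2)
      qed
      also have "\<dots> = emeasure (dens_measure M \<pi>) (space M - S) + ennreal (exp (- C * u))"
        by (simp add: nn_integral_add nn_integral_multc emeasure_prior prior_total)
      also have "\<dots> \<le> ennreal (exp (- C * u)) + ennreal (exp (- C * u))"
        using sieve by (intro add_mono) (auto simp: emeasure_prior_eq intro: ennreal_leI)
      also have "\<dots> = ennreal (2 * exp (- C * u))" by (simp flip: ennreal_plus)
      finally show "(\<integral>\<^sup>+\<xi>. ennreal (\<pi> \<xi>) * indicator U \<xi> * ?\<beta> \<xi> \<partial>M) \<le> ennreal (2 * exp (- C * u))" .
    qed simp
    also have "\<dots> = ennreal (C0 * exp (- C * u) + t powr l * exp (l * (C3 * a)) + 1 / (t * \<rho>) * (2 * exp (- C * u)))"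
      using const pos by (simp flip: ennreal_mult)
    also have "\<dots> \<le> ennreal ((C0 + 3) * exp (- (2 * s) * (real j + 1)))"
    proof (rule ennreal_leI)
      have ju: "real j + 1 \<le> u" using a by (simp add: u_def)
      have decay: "exp (- x) \<le> exp (- (2 * s) * (real j + 1))" if "2 * s * u \<le> x" for x
      proof -
        have "2 * s * (real j + 1) \<le> 2 * s * u" using ju s_pos by (intro mult_left_mono) auto
        then show ?thesis using that by simp
      qed
      have 1: "exp (- (C * u)) \<le> exp (- (2 * s) * (real j + 1))"
        by (rule decay) (use s2 u in \<open>simp add: mult_right_mono\<close>)
      have "t powr l * exp (l * (C3 * a)) = exp (- (l * u + l * C3 * (u - a)))"
        by (simp add: t_def exp_powr_real mult_exp_exp algebra_simps)
      also have "\<dots> \<le> exp (- (2 * s) * (real j + 1))"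
      proof (rule decay)
        have "2 * s * u \<le> l * u" using s2 u by (intro mult_right_mono) auto
        moreover have "0 \<le> l * C3 * (u - a)" using const u by simp
        ultimately show "2 * s * u \<le> l * u + l * C3 * (u - a)" by linarith
      qed
      finally have 2: "t powr l * exp (l * (C3 * a)) \<le> exp (- (2 * s) * (real j + 1))" .
      have "1 / (t * \<rho>) * exp (- C * u) = exp (- ((C - (C2 + C3 + 1)) * u))"
        by (simp add: t_def \<rho>_def exp_minus inverse_eq_divide mult_exp_exp field_simps flip: exp_diff exp_add)
      also have "\<dots> \<le> exp (- (2 * s) * (real j + 1))"
      proof (rule decay)
        have "2 * s \<le> C - (C2 + C3 + 1)" using s2 const by simp
        then show "2 * s * u \<le> (C - (C2 + C3 + 1)) * u" using u by (intro mult_right_mono) auto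
      qed
      finally have 3: "1 / (t * \<rho>) * exp (- C * u) \<le> exp (- (2 * s) * (real j + 1))" .
      have "C0 * exp (- C * u) \<le> C0 * exp (- (2 * s) * (real j + 1))"
        using 1 const by (intro mult_left_mono) auto
      then show "C0 * exp (- C * u) + t powr l * exp (l * (C3 * a)) + 1 / (t * \<rho>) * (2 * exp (- C * u))
        \<le> (C0 + 3) * exp (- (2 * s) * (real j + 1))"
        using 2 3 unfolding distrib_right by linarith
    qed
    finally have "(\<integral>\<^sup>+X. ennreal (p \<xi>\<^sub>0 X) * post_mass X U \<partial>N) \<le> ennreal ((C0 + 3) * exp (- (2 * s) * (real j + 1)))" .
    moreover have "\<forall>\<xi>\<in>space M. ennreal (C1 * (a + real j + 1)) \<le> L \<xi> \<longrightarrow> \<xi> \<in> U"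
      using typeII by (auto simp: U_def u_def)
    ultimately show ?thesis using \<open>U \<in> sets M\<close> by blast
  qed
  obtain U where U': "\<forall>j. U j \<in> sets M \<and> (\<forall>\<xi>\<in>space M. ennreal (C1 * (a + real j + 1)) \<le> L \<xi> \<longrightarrow> \<xi> \<in> U j) \<and>
      (\<integral>\<^sup>+X. ennreal (p \<xi>\<^sub>0 X) * post_mass X (U j) \<partial>N) \<le> ennreal ((C0 + 3) * exp (- (2 * s) * (real j + 1)))"
    using choice[OF allI[OF sets_exist]] by (rule exE)
  have U [measurable]: "U j \<in> sets M"
    and cover: "\<xi> \<in> space M \<Longrightarrow> ennreal (C1 * (a + real j + 1)) \<le> L \<xi> \<Longrightarrow> \<xi> \<in> U j"
    and tail: "(\<integral>\<^sup>+X. ennreal (p \<xi>\<^sub>0 X) * post_mass X (U j) \<partial>N) \<le> ennreal ((C0 + 3) * exp (- (2 * s) * (real j + 1)))" for j \<xi>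
    using U'[rule_format, of j] by auto
  show ?thesis
  proof (intro bexI[of _ "tail_weight s U"] conjI allI ballI)
    show "tail_weight s U \<in> borel_measurable M" unfolding tail_weight_def by measurable
    show "1 \<le> tail_weight s U \<xi>" for \<xi> by (rule tail_weight_ge_1)
    show "L \<xi> \<le> ennreal (C1 * (a + 1)) + ennreal (C1 / s) * ln_ennreal (tail_weight s U \<xi>)" if "\<xi> \<in> space M" for \<xi>
      by (rule loss_le_ln_tail_weight[OF s_pos const(3) a cover[OF that]])
    show "(\<integral>\<^sup>+X. ennreal (p \<xi>\<^sub>0 X) * (\<integral>\<^sup>+\<xi>. ennreal (post X \<xi>) * tail_weight s U \<xi> \<partial>M) \<partial>N)
      \<le> ennreal (1 + (C0 + 3) / (exp s - 1))"
      using const by (intro expected_tail_weight_le[OF \<xi>0 U s_pos _ tail]) simp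
  qed
qed

lemma KL_post_measurable [measurable]:
  assumes [measurable]: "q \<in> borel_measurable M"
  shows "(\<lambda>X. KL M q (post X)) \<in> borel_measurable N"
  unfolding KL_def ext_integral_def by measurable

text \<open>The Gibbs bound for a majorant \<open>a + b log W\<close> of the loss. The right-hand side depends on \<open>q\<close> only
  through the divergence and increases with it, so that a minimiser can be replaced by any competitor.\<close>
lemma variational_expectation_le:
  assumes q: "prob_density_on M q" and X: "X \<in> space N" "0 < evidence X" "evidence X < \<infinity>"
    and W [measurable]: "W \<in> borel_measurable M" and W1: "\<And>\<xi>. 1 \<le> W \<xi>"
  shows "(\<integral>\<^sup>+\<xi>. ennreal (q \<xi>) * (ennreal a + ennreal b * ln_ennreal (W \<xi>)) \<partial>M)
    \<le> ennreal a + ennreal b * (e2ennreal (KL M q (post X)) + (\<integral>\<^sup>+\<xi>. ennreal (post X \<xi>) * W \<xi> \<partial>M))"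
proof -
  have [measurable]: "q \<in> borel_measurable M" and tot: "(\<integral>\<^sup>+\<xi>. ennreal (q \<xi>) \<partial>M) = 1"
    using q by (auto simp: prob_density_on_def)
  have "(\<integral>\<^sup>+\<xi>. ennreal (q \<xi>) * (ennreal a + ennreal b * ln_ennreal (W \<xi>)) \<partial>M)
    = (\<integral>\<^sup>+\<xi>. ennreal (q \<xi>) * ennreal a + ennreal b * (ennreal (q \<xi>) * ln_ennreal (W \<xi>)) \<partial>M)"
    by (simp add: distrib_left mult.left_commute)
  also have "\<dots> = ennreal a + ennreal b * (\<integral>\<^sup>+\<xi>. ennreal (q \<xi>) * ln_ennreal (W \<xi>) \<partial>M)"
    by (simp add: nn_integral_add nn_integral_cmult nn_integral_multc tot)
  also have "\<dots> \<le> ennreal a + ennreal b * (e2ennreal (KL M q (post X)) + (\<integral>\<^sup>+\<xi>. ennreal (post X \<xi>) * W \<xi> \<partial>M))"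
    by (intro add_left_mono mult_left_mono KL_nonneg_and_variational_bound(2) q prob_density_post X W W1) simp
  finally show ?thesis .
qed

lemma variational_expectation_bound_integral:
  assumes \<xi>0: "\<xi>\<^sub>0 \<in> space M" and q: "prob_density_on M q"
    and W [measurable]: "W \<in> borel_measurable M"
    and K: "(\<integral>\<^sup>+X. ennreal (p \<xi>\<^sub>0 X) * (\<integral>\<^sup>+\<xi>. ennreal (post X \<xi>) * W \<xi> \<partial>M) \<partial>N) \<le> ennreal k"
  shows "(\<integral>\<^sup>+X. ennreal a + ennreal b * (e2ennreal (KL M q (post X)) + (\<integral>\<^sup>+\<xi>. ennreal (post X \<xi>) * W \<xi> \<partial>M)) \<partial>dens_measure N (p \<xi>\<^sub>0))
    \<le> ennreal a + ennreal b * ((\<integral>\<^sup>+X. e2ennreal (KL M q (post X)) \<partial>dens_measure N (p \<xi>\<^sub>0)) + ennreal k)"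
proof -
  note [measurable] = measurable_const[OF \<xi>0]
  let ?R = "dens_measure N (p \<xi>\<^sub>0)"
  have [measurable]: "q \<in> borel_measurable M" using q by (auto simp: prob_density_on_def)
  have [measurable_cong]: "sets ?R = sets N" by (simp add: dens_measure_def)
  have tot: "emeasure ?R (space ?R) = 1"
    unfolding dens_measure_def
    by (subst emeasure_density) (simp_all add: likelihood_total[OF \<xi>0] cong: nn_integral_cong)
  have "(\<integral>\<^sup>+X. (\<integral>\<^sup>+\<xi>. ennreal (post X \<xi>) * W \<xi> \<partial>M) \<partial>?R)
    = (\<integral>\<^sup>+X. ennreal (p \<xi>\<^sub>0 X) * (\<integral>\<^sup>+\<xi>. ennreal (post X \<xi>) * W \<xi> \<partial>M) \<partial>N)"
    unfolding dens_measure_def by (rule nn_integral_density) measurable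
  then have W_le: "(\<integral>\<^sup>+X. (\<integral>\<^sup>+\<xi>. ennreal (post X \<xi>) * W \<xi> \<partial>M) \<partial>?R) \<le> ennreal k" using K by simp
  have "(\<integral>\<^sup>+X. ennreal a + ennreal b * (e2ennreal (KL M q (post X)) + (\<integral>\<^sup>+\<xi>. ennreal (post X \<xi>) * W \<xi> \<partial>M)) \<partial>?R)
    = ennreal a + ennreal b * ((\<integral>\<^sup>+X. e2ennreal (KL M q (post X)) \<partial>?R) + (\<integral>\<^sup>+X. (\<integral>\<^sup>+\<xi>. ennreal (post X \<xi>) * W \<xi> \<partial>M) \<partial>?R))"
    by (simp add: nn_integral_add nn_integral_cmult tot)
  also have "\<dots> \<le> ennreal a + ennreal b * ((\<integral>\<^sup>+X. e2ennreal (KL M q (post X)) \<partial>?R) + ennreal k)"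
    by (intro add_left_mono mult_left_mono W_le) simp
  finally show ?thesis .
qed

end

section \<open>Stability of the chance-constrained program\<close>

lemma ext_integral_of_integrable:
  assumes "integrable M h"
  shows "ext_integral M (\<lambda>x. ereal (h x)) = ereal (\<integral>x. h x \<partial>M)"
proof -
  have fin: "(\<integral>\<^sup>+x. ennreal (h x) \<partial>M) < \<infinity>" "(\<integral>\<^sup>+x. ennreal (- h x) \<partial>M) < \<infinity>"
    using assms by (auto simp: real_integrable_def less_top)
  then obtain a b where "(\<integral>\<^sup>+x. ennreal (h x) \<partial>M) = ennreal a" "(\<integral>\<^sup>+x. ennreal (- h x) \<partial>M) = ennreal b" "0 \<le> a" "0 \<le> b"
    by (metis ennreal_cases less_irrefl infinity_ennreal_def)
  then show ?thesis
    by (simp add: ext_integral_def real_lebesgue_integral_def[OF assms])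
qed

lemma ext_integral_of_nonneg:
  assumes "AE x in M. 0 \<le> h x"
  shows "ext_integral M h = enn2ereal (\<integral>\<^sup>+x. e2ennreal (h x) \<partial>M)"
proof -
  have "(\<integral>\<^sup>+x. e2ennreal (- h x) \<partial>M) = (\<integral>\<^sup>+x. 0 \<partial>M)"
    using assms by (intro nn_integral_cong_AE) (auto simp: e2ennreal_neg ereal_uminus_le_0_iff)
  then show ?thesis by (simp add: ext_integral_def zero_ennreal.rep_eq)
qed

text \<open>If the constraint functions at \<open>\<xi>\<close> and at \<open>\<xi>\<^sub>0\<close> cut out different feasible sets only with
  probability below \<open>min \<beta> (1 - \<beta>)\<close>, then the chance constraint selects precisely the points that
  are feasible for \<open>\<xi>\<^sub>0\<close>. The two programs then differ only in their objectives, which are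
  uniformly within \<open>h\<close>, and so are their infima.\<close>
lemma chance_constrained_value_stable:
  fixes f g :: "'a \<Rightarrow> real^'q \<Rightarrow> real" and \<Theta> :: "(real^'q) set"
  assumes f: "\<And>x. x \<in> \<X> \<Longrightarrow> f x \<in> borel_measurable (param_measure \<Theta>)"
    and g: "\<And>x. x \<in> \<X> \<Longrightarrow> g x \<in> borel_measurable (param_measure \<Theta>)"
    and q: "prob_density_on (param_measure \<Theta>) q"
    and H [measurable]: "Hg \<in> borel_measurable (param_measure \<Theta>)" "Hf \<in> borel_measurable (param_measure \<Theta>)"
    and Hg: "\<And>x \<xi>. x \<in> \<X> \<Longrightarrow> \<xi> \<in> \<Theta> \<Longrightarrow> (g x \<xi> \<le> 0) \<noteq> (g x \<xi>\<^sub>0 \<le> 0) \<Longrightarrow> 1 \<le> Hg \<xi>"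
    and Hf: "\<And>x \<xi>. x \<in> \<X> \<Longrightarrow> \<xi> \<in> \<Theta> \<Longrightarrow> ennreal \<bar>f x \<xi> - f x \<xi>\<^sub>0\<bar> \<le> Hf \<xi>"
    and int1: "(\<integral>\<^sup>+\<xi>. ennreal (q \<xi>) * Hg \<xi> \<partial>param_measure \<Theta>) < ennreal m"
    and m: "m \<le> \<beta>" "m \<le> 1 - \<beta>"
    and int2: "(\<integral>\<^sup>+\<xi>. ennreal (q \<xi>) * Hf \<xi> \<partial>param_measure \<Theta>) \<le> ennreal h" and h: "0 \<le> h"
    and sol: "\<exists>x\<in>\<X>. g x \<xi>\<^sub>0 \<le> 0 \<and> (\<forall>y\<in>\<X>. g y \<xi>\<^sub>0 \<le> 0 \<longrightarrow> f x \<xi>\<^sub>0 \<le> f y \<xi>\<^sub>0)"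
  shows "\<bar>VB_value \<X> \<Theta> f g \<beta> q - true_value \<X> f g \<xi>\<^sub>0\<bar> \<le> ereal h"
proof -
  let ?M = "param_measure \<Theta>"
  define R where "R = dens_measure ?M q"
  have space_M: "space ?M = \<Theta>" by (simp add: param_measure_def space_restrict_space)
  have [measurable]: "q \<in> borel_measurable ?M"
    and tot: "(\<integral>\<^sup>+\<xi>. ennreal (q \<xi>) \<partial>?M) = 1"
    using q by (auto simp: prob_density_on_def)
  have [measurable_cong, simp]: "sets R = sets ?M" and space_R: "space R = \<Theta>"
    by (simp_all add: R_def dens_measure_def space_M)
  have "emeasure R (space ?M) = 1"
    unfolding R_def dens_measure_def
    by (subst emeasure_density) (simp_all add: tot cong: nn_integral_cong)
  then have R1: "emeasure R \<Theta> = 1" by (simp add: space_M)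
  interpret R: finite_measure R by standard (simp add: space_R R1)
  have R1': "measure R \<Theta> = 1" by (simp add: measure_def R1)
  have feasible: "(\<beta> \<le> measure R {\<xi>\<in>\<Theta>. g x \<xi> \<le> 0}) = (g x \<xi>\<^sub>0 \<le> 0)" if x: "x \<in> \<X>" for x
  proof -
    note [measurable] = g[OF x]
    define B where "B = {\<xi>\<in>space ?M. (g x \<xi> \<le> 0) \<noteq> (g x \<xi>\<^sub>0 \<le> 0)}"
    have [measurable]: "B \<in> sets ?M" unfolding B_def by measurable
    have "emeasure R B = (\<integral>\<^sup>+\<xi>. ennreal (q \<xi>) * indicator B \<xi> \<partial>?M)"
      unfolding R_def dens_measure_def by (rule emeasure_density) measurable
    also have "\<dots> \<le> (\<integral>\<^sup>+\<xi>. ennreal (q \<xi>) * Hg \<xi> \<partial>?M)"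
      using Hg[OF x] by (intro nn_integral_mono mult_left_mono) (auto simp: B_def indicator_def space_M)
    finally have "emeasure R B < ennreal m" using int1 by simp
    then have small: "measure R B < m"
      by (simp add: R.emeasure_eq_measure ennreal_less_iff)
    show ?thesis
    proof (cases "g x \<xi>\<^sub>0 \<le> 0")
      case True
      have "measure R {\<xi>\<in>\<Theta>. g x \<xi> \<le> 0} = measure R (space R - B)"
        using True by (intro arg_cong[where f = "measure R"]) (auto simp: B_def space_M space_R)
      also have "\<dots> = 1 - measure R B"
        by (subst R.finite_measure_compl) (simp_all add: space_R R1')
      finally show ?thesis using True small m by simp
    next
      case False
      then have "{\<xi>\<in>\<Theta>. g x \<xi> \<le> 0} = B" by (auto simp: B_def space_M)
      then show ?thesis using False small m by simp
    qed
  qed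
  define F where "F x = (\<integral>\<xi>. f x \<xi> \<partial>R)" for x
  have close: "\<bar>F x - f x \<xi>\<^sub>0\<bar> \<le> h" and ext: "ext_integral R (\<lambda>\<xi>. ereal (f x \<xi>)) = ereal (F x)"
    if x: "x \<in> \<X>" for x
  proof -
    note [measurable] = f[OF x]
    let ?d = "\<lambda>\<xi>. f x \<xi> - f x \<xi>\<^sub>0"
    have "(\<integral>\<^sup>+\<xi>. ennreal (norm (?d \<xi>)) \<partial>R) = (\<integral>\<^sup>+\<xi>. ennreal (q \<xi>) * ennreal (norm (?d \<xi>)) \<partial>?M)"
      unfolding R_def dens_measure_def by (rule nn_integral_density) measurable
    also have "\<dots> \<le> (\<integral>\<^sup>+\<xi>. ennreal (q \<xi>) * Hf \<xi> \<partial>?M)"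
      using Hf[OF x] by (intro nn_integral_mono mult_left_mono) (auto simp: space_M)
    finally have le: "(\<integral>\<^sup>+\<xi>. ennreal (norm (?d \<xi>)) \<partial>R) \<le> ennreal h" using int2 by (rule order.trans)
    have int_d: "integrable R ?d"
      by (rule integrableI_bounded) (use le in \<open>auto intro: le_less_trans\<close>)
    then have "integrable R (\<lambda>\<xi>. ?d \<xi> + f x \<xi>\<^sub>0)" by (intro Bochner_Integration.integrable_add) auto
    then have int_f: "integrable R (f x)" by simp
    then show "ext_integral R (\<lambda>\<xi>. ereal (f x \<xi>)) = ereal (F x)"
      unfolding F_def by (rule ext_integral_of_integrable)
    have "F x - f x \<xi>\<^sub>0 = (\<integral>\<xi>. ?d \<xi> \<partial>R)"
      unfolding F_def using int_f by (simp add: R1' space_R)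
    then have "ennreal \<bar>F x - f x \<xi>\<^sub>0\<bar> \<le> (\<integral>\<^sup>+\<xi>. ennreal (norm (?d \<xi>)) \<partial>R)"
      using integral_norm_bound_ennreal[OF int_d] by simp
    with le have "ennreal \<bar>F x - f x \<xi>\<^sub>0\<bar> \<le> ennreal h" by (rule order.trans[rotated])
    then show "\<bar>F x - f x \<xi>\<^sub>0\<bar> \<le> h" using h by simp
  qed
  let ?S = "{x\<in>\<X>. g x \<xi>\<^sub>0 \<le> 0}"
  obtain z where z: "z \<in> ?S" and zmin: "\<And>y. y \<in> ?S \<Longrightarrow> f z \<xi>\<^sub>0 \<le> f y \<xi>\<^sub>0" using sol by auto
  have true: "true_value \<X> f g \<xi>\<^sub>0 = ereal (f z \<xi>\<^sub>0)"
    unfolding true_value_def opt_value_def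
    by (rule antisym) (auto intro!: INF_lower2[OF z] INF_greatest zmin)
  have "{x\<in>\<X>. \<beta> \<le> measure (dens_measure ?M q) {\<xi>\<in>\<Theta>. g x \<xi> \<le> 0}} = ?S"
    using feasible by (auto simp: R_def)
  then have VB: "VB_value \<X> \<Theta> f g \<beta> q = (INF x\<in>?S. ereal (F x))"
    unfolding VB_value_def opt_value_def using ext by (auto simp: R_def intro!: INF_cong)
  have upper: "VB_value \<X> \<Theta> f g \<beta> q \<le> ereal (f z \<xi>\<^sub>0 + h)"
    unfolding VB using close[of z] z by (intro INF_lower2[OF z]) (auto simp: abs_le_iff)
  have lower: "ereal (f z \<xi>\<^sub>0 - h) \<le> VB_value \<X> \<Theta> f g \<beta> q"
    unfolding VB
  proof (rule INF_greatest)
    fix y assume y: "y \<in> ?S"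
    show "ereal (f z \<xi>\<^sub>0 - h) \<le> ereal (F y)"
      using close[of y] zmin[OF y] y by (auto simp: abs_le_iff)
  qed
  obtain v where "VB_value \<X> \<Theta> f g \<beta> q = ereal v"
    using upper lower by (cases "VB_value \<X> \<Theta> f g \<beta> q") auto
  then show ?thesis using upper lower by (auto simp: true abs_le_iff)
qed

section \<open>Markov bounds for sets that need not be measurable\<close>

text \<open>The event that the optimal value deviates involves a minimiser chosen separately for each data
  set, so it need not be measurable; it is covered by level sets of measurable bounds.\<close>
lemma outer_measure_le_two_Markov:
  assumes [measurable]: "B1 \<in> borel_measurable R" "B2 \<in> borel_measurable R" and pos: "0 < m" "0 < h"
    and E: "E \<subseteq> space R" "AE X in R. X \<in> E \<longrightarrow> ennreal m \<le> B1 X \<or> ennreal h \<le> B2 X"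
  shows "outer_measure_of R E \<le> ennreal (1 / m) * (\<integral>\<^sup>+X. B1 X \<partial>R) + ennreal (1 / h) * (\<integral>\<^sup>+X. B2 X \<partial>R)"
proof -
  obtain Z where Z: "{X\<in>space R. \<not> (X \<in> E \<longrightarrow> ennreal m \<le> B1 X \<or> ennreal h \<le> B2 X)} \<subseteq> Z"
    and Z0: "emeasure R Z = 0" and [measurable]: "Z \<in> sets R"
    using E(2) by (rule AE_E)
  have Markov: "emeasure R {X\<in>space R. ennreal c \<le> B X} \<le> ennreal (1 / c) * (\<integral>\<^sup>+X. B X \<partial>R)"
    if [measurable]: "B \<in> borel_measurable R" and c: "0 < c" for B c
  proof -
    have "1 \<le> ennreal (1 / c) * B X" if "ennreal c \<le> B X" for X
    proof -
      have "ennreal (1 / c) * ennreal c \<le> ennreal (1 / c) * B X"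
        using that by (intro mult_left_mono) auto
      then show ?thesis using c by (simp flip: ennreal_mult)
    qed
    then have "emeasure R {X\<in>space R. ennreal c \<le> B X} \<le> emeasure R {X\<in>space R. 1 \<le> ennreal (1 / c) * B X}"
      by (intro emeasure_mono) auto
    also have "\<dots> \<le> ennreal (1 / c) * (\<integral>\<^sup>+X. B X * indicator (space R) X \<partial>R)"
      by (intro nn_integral_Markov_inequality) auto
    also have "(\<integral>\<^sup>+X. B X * indicator (space R) X \<partial>R) = (\<integral>\<^sup>+X. B X \<partial>R)"
      by (intro nn_integral_cong) simp
    finally show ?thesis .
  qed
  let ?E1 = "{X\<in>space R. ennreal m \<le> B1 X}" and ?E2 = "{X\<in>space R. ennreal h \<le> B2 X}"
  have "E \<subseteq> Z \<union> ?E1 \<union> ?E2" using Z E(1) by blast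
  then have "outer_measure_of R E \<le> outer_measure_of R (Z \<union> ?E1 \<union> ?E2)" by (rule outer_measure_of_mono)
  also have "\<dots> = emeasure R (Z \<union> ?E1 \<union> ?E2)" by (rule outer_measure_of_eq) measurable
  also have "\<dots> \<le> emeasure R Z + emeasure R ?E1 + emeasure R ?E2"
    by (intro order.trans[OF emeasure_subadditive] add_right_mono emeasure_subadditive) auto
  also have "\<dots> \<le> 0 + ennreal (1 / m) * (\<integral>\<^sup>+X. B1 X \<partial>R) + ennreal (1 / h) * (\<integral>\<^sup>+X. B2 X \<partial>R)"
    using Z0 pos by (intro add_mono Markov) auto
  finally show ?thesis by simp
qed

text \<open>If the infimum is infinite, as for an empty family, then so is the bound. Otherwise members whose
  value is within any positive distance of the infimum give the bound up to a proportional error.\<close>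
lemma le_affine_INF:
  fixes G :: "'b \<Rightarrow> ennreal"
  assumes c: "0 < c" and b: "0 \<le> b" and d: "0 < d"
    and le: "\<And>q. q \<in> Q \<Longrightarrow> v \<le> ennreal c * (ennreal b + ennreal d * G q)"
  shows "enn2ereal v \<le> ereal c * (ereal b + ereal d * (INF q\<in>Q. enn2ereal (G q)))"
proof (cases "(INF q\<in>Q. enn2ereal (G q))")
  case PInf
  then show ?thesis using c d by simp
next
  case MInf
  have "0 \<le> (INF q\<in>Q. enn2ereal (G q))" by (intro INF_greatest) simp
  then show ?thesis using MInf by simp
next
  case (real i)
  have "0 \<le> (INF q\<in>Q. enn2ereal (G q))" by (intro INF_greatest) simp
  then have i: "0 \<le> i" using real by simp
  have "v \<le> ennreal (c * (b + d * i))"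
  proof (rule ennreal_le_epsilon)
    fix e :: real assume e: "0 < e"
    define y where "y = i + e / (c * d)"
    have y: "i < y" using e c d by (simp add: y_def)
    then have "(INF q\<in>Q. enn2ereal (G q)) < ereal y" using real by simp
    then obtain q where q: "q \<in> Q" "enn2ereal (G q) < ereal y" by (auto simp: INF_less_iff)
    have "G q \<le> ennreal y"
      using q(2) i y by (cases "G q") (auto simp: enn2ereal_ennreal ennreal_leI)
    then have "v \<le> ennreal c * (ennreal b + ennreal d * ennreal y)"
      by (intro order.trans[OF le[OF q(1)]] mult_left_mono add_left_mono) auto
    also have "\<dots> = ennreal (c * (b + d * y))"
      using c b d i y by (simp flip: ennreal_mult ennreal_plus)
    also have "c * (b + d * y) = c * (b + d * i) + e"
      using c d by (simp add: y_def field_simps)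
    also have "ennreal \<dots> = ennreal (c * (b + d * i)) + ennreal e"
      using c b d i e by (intro ennreal_plus) auto
    finally show "v \<le> ennreal (c * (b + d * i)) + ennreal e" .
  qed
  then have "enn2ereal v \<le> ereal (c * (b + d * i))"
    using c b d i by (cases v) (auto simp: enn2ereal_ennreal top_unique)
  then show ?thesis using real by simp
qed

section \<open>The test condition and the losses at a fixed sample size\<close>

text \<open>The tests at \<open>e = sqrt (u / n)\<close> have \<open>n e\<^sup>2 = u\<close>, so the conditions can be read in terms of the
  exponent \<open>u\<close>.\<close>
lemma test_and_sieve_at_level:
  assumes test: "test_condition \<Theta> \<xi>\<^sub>0 P L \<epsilon> S C C0 C1" and sieve: "sieve_mass_condition \<Theta> \<pi> \<epsilon> S C"
    and n: "n \<ge> 1" and \<epsilon>: "0 < \<epsilon> n" and u: "real n * (\<epsilon> n)\<^sup>2 < u" and \<Theta>: "\<Theta> \<in> sets borel" and \<xi>0: "\<xi>\<^sub>0 \<in> \<Theta>"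
    and P: "\<And>\<xi>. P n \<xi> = dens_measure N (p \<xi>)" and p: "\<And>\<xi>. \<xi> \<in> \<Theta> \<Longrightarrow> p \<xi> \<in> borel_measurable N"
  shows "\<exists>S\<in>sets (param_measure \<Theta>). \<exists>\<phi>\<in>borel_measurable N. (\<forall>X. 0 \<le> \<phi> X \<and> \<phi> X \<le> (1::real)) \<and>
      (\<integral>\<^sup>+X. ennreal (p \<xi>\<^sub>0 X) * ennreal (\<phi> X) \<partial>N) \<le> ennreal (C0 * exp (- C * u)) \<and>
      (\<forall>\<xi>\<in>S. ennreal (C1 * u) \<le> L n \<xi> \<xi>\<^sub>0 \<longrightarrow>
        (\<integral>\<^sup>+X. ennreal (p \<xi> X) * ennreal (1 - \<phi> X) \<partial>N) \<le> ennreal (exp (- C * u))) \<and>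
      measure (dens_measure (param_measure \<Theta>) \<pi>) (space (param_measure \<Theta>) - S) \<le> exp (- C * u)"
proof -
  define e where "e = sqrt (u / real n)"
  have "(\<epsilon> n)\<^sup>2 < u / real n" using u n by (simp add: field_simps)
  then have e: "\<epsilon> n < e" unfolding e_def by (rule real_less_rsqrt)
  have "0 < u" using u n by (meson le_less_trans mult_nonneg_nonneg of_nat_0_le_iff zero_le_power2)
  then have ne: "real n * e\<^sup>2 = u" using n by (simp add: e_def)
  obtain \<phi> where S: "S n e \<in> sets borel" "S n e \<subseteq> \<Theta>" and \<phi>: "\<phi> \<in> borel_measurable (P n \<xi>\<^sub>0)"
    and \<phi>01: "\<forall>X. 0 \<le> \<phi> X \<and> \<phi> X \<le> (1::real)"
    and I: "(\<integral>\<^sup>+X. ennreal (\<phi> X) \<partial>P n \<xi>\<^sub>0) \<le> ennreal (C0 * exp (- C * real n * e\<^sup>2))"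
    and II: "(SUP \<xi>\<in>{\<xi>\<in>S n e. L n \<xi> \<xi>\<^sub>0 \<ge> ennreal (C1 * real n * e\<^sup>2)}.
              \<integral>\<^sup>+X. ennreal (1 - \<phi> X) \<partial>P n \<xi>) \<le> ennreal (exp (- C * real n * e\<^sup>2))"
    using test[unfolded test_condition_def, rule_format, OF n e] by (elim conjE bexE)
  have eqs: "- C * real n * e\<^sup>2 = - C * u" "C1 * real n * e\<^sup>2 = C1 * u" by (simp_all flip: ne)
  have \<phi>' [measurable]: "\<phi> \<in> borel_measurable N"
    using \<phi> by (simp add: P dens_measure_def measurable_def)
  have dens: "(\<integral>\<^sup>+X. ennreal (\<psi> X) \<partial>P n \<xi>) = (\<integral>\<^sup>+X. ennreal (p \<xi> X) * ennreal (\<psi> X) \<partial>N)"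
    if "\<xi> \<in> \<Theta>" and [measurable]: "\<psi> \<in> borel_measurable N" for \<xi> and \<psi> :: "'b \<Rightarrow> real"
  proof -
    note [measurable] = p[OF that(1)]
    show ?thesis unfolding P dens_measure_def by (rule nn_integral_density) measurable
  qed
  show ?thesis
  proof (intro bexI[of _ "S n e"] bexI[of _ \<phi>] conjI \<phi>01 \<phi>' ballI impI)
    show "S n e \<in> sets (param_measure \<Theta>)"
      unfolding param_measure_def using S \<Theta> by (subst sets_restrict_space_iff) auto
    show "(\<integral>\<^sup>+X. ennreal (p \<xi>\<^sub>0 X) * ennreal (\<phi> X) \<partial>N) \<le> ennreal (C0 * exp (- C * u))"
      using I by (simp only: dens[OF \<xi>0 \<phi>'] eqs)
    show "(\<integral>\<^sup>+X. ennreal (p \<xi> X) * ennreal (1 - \<phi> X) \<partial>N) \<le> ennreal (exp (- C * u))"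
      if \<xi>: "\<xi> \<in> S n e" and "ennreal (C1 * u) \<le> L n \<xi> \<xi>\<^sub>0" for \<xi>
    proof -
      have "\<xi> \<in> \<Theta>" using S \<xi> by auto
      then have "(\<integral>\<^sup>+X. ennreal (p \<xi> X) * ennreal (1 - \<phi> X) \<partial>N) = (\<integral>\<^sup>+X. ennreal (1 - \<phi> X) \<partial>P n \<xi>)"
        by (subst dens) measurable
      also have "\<dots> \<le> ennreal (exp (- C * real n * e\<^sup>2))"
        by (rule order.trans[OF SUP_upper II]) (use that in \<open>simp add: eqs\<close>)
      finally show ?thesis by (simp only: eqs)
    qed
    show "measure (dens_measure (param_measure \<Theta>) \<pi>) (space (param_measure \<Theta>) - S n e) \<le> exp (- C * u)"
      using sieve[unfolded sieve_mass_condition_def, rule_format, OF n e]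
      by (simp only: eqs) (simp add: param_measure_def space_restrict_space)
  qed
qed

lemma dominated_model_param_data:
  fixes \<Theta> :: "(real^'q) set" and p :: "real^'q \<Rightarrow> (nat \<Rightarrow> real^'d) \<Rightarrow> real"
  assumes "\<Theta> \<in> sets borel"
    and "(\<lambda>(\<xi>, X). p \<xi> X) \<in> borel_measurable (param_measure \<Theta> \<Otimes>\<^sub>M data_measure n)"
    and "\<And>\<xi>. \<xi> \<in> \<Theta> \<Longrightarrow> prob_density_on (data_measure n) (p \<xi>)"
    and "prob_density_on (param_measure \<Theta>) \<pi>"
  shows "dominated_model (param_measure \<Theta>) (data_measure n) p \<pi>"
proof -
  interpret leb: product_sigma_finite "\<lambda>_::nat. lborel :: (real^'d) measure" ..
  interpret M: sigma_finite_measure "param_measure \<Theta>"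
    unfolding param_measure_def using assms(1)
    by (intro sigma_finite_measure_restrict_space) (auto simp: sigma_finite_lborel)
  interpret N: sigma_finite_measure "data_measure n :: (nat \<Rightarrow> real^'d) measure"
    unfolding data_measure_def by (rule leb.sigma_finite) simp
  show ?thesis
    using assms by unfold_locales (auto simp: param_measure_def space_restrict_space)
qed

lemma ennreal_inverse_times_of_nat:
  assumes "n \<ge> 1" shows "ennreal (1 / real n) * (of_nat n * t) = t"
  using assms by (simp add: ennreal_of_nat_eq_real_of_nat flip: mult.assoc ennreal_mult)

lemma one_le_mean_loss1:
  assumes "n \<ge> 1" "x \<in> \<X>" "(g x \<xi> \<le> 0) \<noteq> (g x \<xi>\<^sub>0 \<le> 0)"
  shows "1 \<le> ennreal (1 / real n) * loss1 \<X> g n \<xi> \<xi>\<^sub>0"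
  unfolding loss1_def ennreal_inverse_times_of_nat[OF assms(1)]
  by (rule SUP_upper2[OF assms(2)]) (use assms(3) in \<open>auto simp: indicator_def\<close>)

lemma abs_diff_le_mean_loss2:
  assumes "n \<ge> 1" "x \<in> \<X>"
  shows "ennreal \<bar>f x \<xi> - f x \<xi>\<^sub>0\<bar> \<le> ennreal (1 / real n) * loss2 \<X> f n \<xi> \<xi>\<^sub>0"
  unfolding loss2_def ennreal_inverse_times_of_nat[OF assms(1)] using assms(2) by (rule SUP_upper)

lemma mean_majorant:
  assumes "n \<ge> 1" "0 \<le> a" "0 \<le> b" "L \<le> ennreal a + ennreal b * w"
  shows "ennreal (1 / real n) * L \<le> ennreal (a / real n) + ennreal (b / real n) * w"
proof -
  have "ennreal (1 / real n) * L \<le> ennreal (1 / real n) * (ennreal a + ennreal b * w)"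
    using assms(4) by (rule mult_left_mono) simp
  also have "\<dots> = ennreal (a / real n) + ennreal (b / real n) * w"
    using assms by (simp add: distrib_left flip: mult.assoc ennreal_mult)
  finally show ?thesis .
qed

section \<open>Deviation of the variational optimal value\<close>

theorem theorem4p2:
  fixes \<X> :: "(real^'p) set" and \<Theta> :: "(real^'q) set" and \<xi>\<^sub>0 :: "real^'q"
    and f g :: "real^'p \<Rightarrow> real^'q \<Rightarrow> real"
    and p :: "nat \<Rightarrow> real^'q \<Rightarrow> (nat \<Rightarrow> real^'d) \<Rightarrow> real"
    and P :: "nat \<Rightarrow> real^'q \<Rightarrow> (nat \<Rightarrow> real^'d) measure"
    and \<pi> :: "real^'q \<Rightarrow> real"
    and \<Q> :: "(real^'q \<Rightarrow> real) set"
    and qstar :: "nat \<Rightarrow> (nat \<Rightarrow> real^'d) \<Rightarrow> real^'q \<Rightarrow> real"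
    and \<epsilon> :: "nat \<Rightarrow> real" and \<beta> C C0 C1 C2 C3 l :: real
    and S1 S2 :: "nat \<Rightarrow> real \<Rightarrow> (real^'q) set"
  assumes "convex \<X>" and "compact \<X>"
    and "\<Theta> \<in> sets borel" and "\<xi>\<^sub>0 \<in> \<Theta>"
    and "\<And>x. x \<in> \<X> \<Longrightarrow> f x \<in> borel_measurable (param_measure \<Theta>)"
    and "\<And>x. x \<in> \<X> \<Longrightarrow> g x \<in> borel_measurable (param_measure \<Theta>)"
    and "AE \<xi> in param_measure \<Theta>.
           continuous_on \<X> (\<lambda>x. f x \<xi>) \<and> continuous_on \<X> (\<lambda>x. g x \<xi>)"
    and "\<And>n. n \<ge> 1 \<Longrightarrow>
           (\<lambda>(\<xi>, X). p n \<xi> X) \<in> borel_measurable (param_measure \<Theta> \<Otimes>\<^sub>M data_measure n)"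
    and "\<And>n \<xi>. n \<ge> 1 \<Longrightarrow> \<xi> \<in> \<Theta> \<Longrightarrow> prob_density_on (data_measure n) (p n \<xi>)"
    and P_def: "\<And>n \<xi>. P n \<xi> = dens_measure (data_measure n) (p n \<xi>)"
    and "prob_density_on (param_measure \<Theta>) \<pi>"
    and "\<And>q. q \<in> \<Q> \<Longrightarrow> prob_density_on (param_measure \<Theta>) q"
    and "\<And>n. n \<ge> 1 \<Longrightarrow> AE X in P n \<xi>\<^sub>0.
           is_arg_min (\<lambda>q. KL (param_measure \<Theta>) q (posterior \<Theta> \<pi> (p n) X)) (\<lambda>q. q \<in> \<Q>) (qstar n X)"
    and "\<exists>x\<in>\<X>. g x \<xi>\<^sub>0 \<le> 0 \<and> (\<forall>y\<in>\<X>. g y \<xi>\<^sub>0 \<le> 0 \<longrightarrow> f x \<xi>\<^sub>0 \<le> f y \<xi>\<^sub>0)"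
    and "0 < \<beta>" and "\<beta> < 1"
    and "\<And>n. n \<ge> 1 \<Longrightarrow> \<epsilon> n > 0" and "\<And>n. n \<ge> 1 \<Longrightarrow> real n * (\<epsilon> n)\<^sup>2 \<ge> 1"
    and "(\<lambda>n. (\<epsilon> n)\<^sup>2) \<longlonglongrightarrow> 0"
    and "C > 0" and "C0 > 0" and "C1 > 0" and "C2 > 0" and "C3 > 0" and "l > 0"
    and "test_condition \<Theta> \<xi>\<^sub>0 P (loss1 \<X> g) \<epsilon> S1 C C0 C1"
    and "test_condition \<Theta> \<xi>\<^sub>0 P (loss2 \<X> f) \<epsilon> S2 C C0 C1"
    and "sieve_mass_condition \<Theta> \<pi> \<epsilon> S1 C" and "sieve_mass_condition \<Theta> \<pi> \<epsilon> S2 C"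
    and "prior_mass_condition \<Theta> \<pi> \<xi>\<^sub>0 P \<epsilon> l C2 C3"
    and "C > C2 + C3 + 2"
  shows "\<exists>M1>0. \<exists>M2>0. \<forall>n\<ge>1. \<forall>\<eta>>0. \<forall>\<delta>\<in>{0<..<\<beta>}.
           enn2ereal (outer_measure_of (P n \<xi>\<^sub>0)
             {X \<in> space (P n \<xi>\<^sub>0).
                \<bar>VB_value \<X> \<Theta> f g \<beta> (qstar n X) - true_value \<X> f g \<xi>\<^sub>0\<bar> > ereal (2 * \<eta>)})
           \<le> ereal (M1 / min \<delta> (1 - \<beta>) + M2 / \<eta>)
               * (ereal ((\<epsilon> n)\<^sup>2) + eta_sq \<Theta> \<pi> \<Q> \<xi>\<^sub>0 p n)"
proof -
  note \<Theta> = assms(3) and \<xi>0 = assms(4) and f = assms(5) and g = assms(6) and p_meas = assms(8)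
    and p_dens = assms(9) and \<pi> = assms(11) and \<Q> = assms(12) and argmin = assms(13) and sol = assms(14)
    and \<beta> = assms(15,16) and \<epsilon>_pos = assms(17) and n\<epsilon> = assms(18)
    and const = assms(20-25) and test1 = assms(26) and test2 = assms(27)
    and sieve1 = assms(28) and sieve2 = assms(29) and prior = assms(30) and C_big = assms(31)
  define s where "s = min C (min l 1) / 2"
  define K where "K = 1 + (C0 + 3) / (exp s - 1)"
  \<comment> \<open>The constant absorbs \<open>C1 (a + 1) + C1 K / s \<le> D a\<close>, where \<open>a = n \<epsilon>\<^sup>2 \<ge> 1\<close>.\<close>
  define D where "D = 2 * C1 + C1 * (K + 1) / s"
  have s: "0 < s" using const by (simp add: s_def)
  have K: "0 < K" using s const by (auto simp: K_def intro!: add_pos_nonneg)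
  have D: "0 < D" using s K const by (auto simp: D_def intro!: add_pos_pos)
  have main: "enn2ereal (outer_measure_of (P n \<xi>\<^sub>0)
       {X \<in> space (P n \<xi>\<^sub>0). \<bar>VB_value \<X> \<Theta> f g \<beta> (qstar n X) - true_value \<X> f g \<xi>\<^sub>0\<bar> > ereal (2 * \<eta>)})
     \<le> ereal (D / min \<delta> (1 - \<beta>) + D / \<eta>) * (ereal ((\<epsilon> n)\<^sup>2) + eta_sq \<Theta> \<pi> \<Q> \<xi>\<^sub>0 p n)"
    if n: "n \<ge> 1" and \<eta>: "\<eta> > 0" and \<delta>: "\<delta> \<in> {0<..<\<beta>}" for n \<eta> \<delta>
  proof -
    let ?M = "param_measure \<Theta>" and ?N = "data_measure n :: (nat \<Rightarrow> real^'d) measure"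
    interpret dominated_model ?M ?N "p n" \<pi>
      by (rule dominated_model_param_data[OF \<Theta> p_meas[OF n] p_dens[OF n] \<pi>])
    have space_M: "space ?M = \<Theta>" by (simp add: param_measure_def space_restrict_space)
    have \<xi>0M: "\<xi>\<^sub>0 \<in> space ?M" using \<xi>0 by (simp add: space_M)
    note [measurable] = measurable_const[OF \<xi>0M]
    have P: "P n \<xi> = dens_measure ?N (p n \<xi>)" for \<xi> by (rule P_def)
    let ?P = "P n \<xi>\<^sub>0"
    have sets_P [measurable_cong]: "sets ?P = sets ?N" and space_P: "space ?P = space ?N"
      by (simp_all add: P dens_measure_def)
    have p_fin: "p n \<xi> \<in> borel_measurable ?N" if "\<xi> \<in> \<Theta>" for \<xi>
      using p_dens[OF n that] by (simp add: prob_density_on_def)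
    have post_eq: "posterior \<Theta> \<pi> (p n) = post"
      by (intro ext) (simp add: posterior_def post_def)
    define a where "a = real n * (\<epsilon> n)\<^sup>2"
    have a: "1 \<le> a" using n\<epsilon>[OF n] by (simp add: a_def)
    define A where "A = {\<xi>\<in>\<Theta>. renyi_divergence l (P n \<xi>\<^sub>0) (P n \<xi>) \<le> ereal (C3 * real n * (\<epsilon> n)\<^sup>2)}"
    have A: "A \<subseteq> space ?M" by (auto simp: A_def space_M)
    have prior_A: "exp (- C2 * a) \<le> measure (dens_measure ?M \<pi>) A"
      using prior n unfolding prior_mass_condition_def A_def a_def by (simp add: mult_ac)
    have renyi: "renyi_divergence l (dens_measure ?N (p n \<xi>\<^sub>0)) (dens_measure ?N (p n \<xi>)) \<le> ereal (C3 * a)"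
      if "\<xi> \<in> A" for \<xi>
      using that by (simp add: A_def a_def P mult_ac)
    have prior_A_pos: "0 < measure (dens_measure ?M \<pi>) A"
      using prior_A by (rule less_le_trans[rotated]) simp
    have a0: "0 \<le> a" using a by simp
    define k0 where "k0 = C1 * (a + 1) / real n"
    define k1 where "k1 = C1 / s / real n"
    have k: "0 \<le> k0" "0 \<le> k1" using const a s by (auto simp: k0_def k1_def)
    have majorant: "\<exists>W\<in>borel_measurable ?M. (\<forall>\<xi>. 1 \<le> W \<xi>) \<and>
        (\<forall>\<xi>\<in>\<Theta>. ennreal (1 / real n) * L n \<xi> \<xi>\<^sub>0 \<le> ennreal k0 + ennreal k1 * ln_ennreal (W \<xi>)) \<and>
        (\<integral>\<^sup>+X. ennreal (p n \<xi>\<^sub>0 X) * (\<integral>\<^sup>+\<xi>. ennreal (post X \<xi>) * W \<xi> \<partial>?M) \<partial>?N) \<le> ennreal K"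
      if L: "test_condition \<Theta> \<xi>\<^sub>0 P L \<epsilon> S C C0 C1" "sieve_mass_condition \<Theta> \<pi> \<epsilon> S C" for L S
    proof -
      note test = test_and_sieve_at_level[OF L n \<epsilon>_pos[OF n] _ \<Theta> \<xi>0 P p_fin, folded a_def]
      have "\<exists>W\<in>borel_measurable ?M. (\<forall>\<xi>. 1 \<le> W \<xi>) \<and>
        (\<forall>\<xi>\<in>space ?M. L n \<xi> \<xi>\<^sub>0 \<le> ennreal (C1 * (a + 1)) + ennreal (C1 / s) * ln_ennreal (W \<xi>)) \<and>
        (\<integral>\<^sup>+X. ennreal (p n \<xi>\<^sub>0 X) * (\<integral>\<^sup>+\<xi>. ennreal (post X \<xi>) * W \<xi> \<partial>?M) \<partial>?N) \<le> ennreal (1 + (C0 + 3) / (exp s - 1))"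
        by (rule posterior_loss_majorant[OF \<xi>0M a0 const C_big s_def A prior_A renyi test])
      then obtain W where W: "W \<in> borel_measurable ?M" "\<forall>\<xi>. 1 \<le> W \<xi>"
        "\<forall>\<xi>\<in>space ?M. L n \<xi> \<xi>\<^sub>0 \<le> ennreal (C1 * (a + 1)) + ennreal (C1 / s) * ln_ennreal (W \<xi>)"
        "(\<integral>\<^sup>+X. ennreal (p n \<xi>\<^sub>0 X) * (\<integral>\<^sup>+\<xi>. ennreal (post X \<xi>) * W \<xi> \<partial>?M) \<partial>?N) \<le> ennreal (1 + (C0 + 3) / (exp s - 1))"
        by (elim bexE conjE)
      have "ennreal (1 / real n) * L n \<xi> \<xi>\<^sub>0 \<le> ennreal k0 + ennreal k1 * ln_ennreal (W \<xi>)" if "\<xi> \<in> \<Theta>" for \<xi>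
        unfolding k0_def k1_def
        by (rule mean_majorant[OF n _ _ bspec[OF W(3)]]) (use that const a s in \<open>auto simp: space_M\<close>)
      then show ?thesis using W by (auto simp: K_def)
    qed
    obtain W1 where W1 [measurable]: "W1 \<in> borel_measurable ?M" and W1_ge': "\<forall>\<xi>. 1 \<le> W1 \<xi>"
      and mean_loss1: "\<forall>\<xi>\<in>\<Theta>. ennreal (1 / real n) * loss1 \<X> g n \<xi> \<xi>\<^sub>0 \<le> ennreal k0 + ennreal k1 * ln_ennreal (W1 \<xi>)"
      and W1_int: "(\<integral>\<^sup>+X. ennreal (p n \<xi>\<^sub>0 X) * (\<integral>\<^sup>+\<xi>. ennreal (post X \<xi>) * W1 \<xi> \<partial>?M) \<partial>?N) \<le> ennreal K"
      using majorant[OF test1 sieve1] by (elim bexE conjE)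
    obtain W2 where W2 [measurable]: "W2 \<in> borel_measurable ?M" and W2_ge': "\<forall>\<xi>. 1 \<le> W2 \<xi>"
      and mean_loss2: "\<forall>\<xi>\<in>\<Theta>. ennreal (1 / real n) * loss2 \<X> f n \<xi> \<xi>\<^sub>0 \<le> ennreal k0 + ennreal k1 * ln_ennreal (W2 \<xi>)"
      and W2_int: "(\<integral>\<^sup>+X. ennreal (p n \<xi>\<^sub>0 X) * (\<integral>\<^sup>+\<xi>. ennreal (post X \<xi>) * W2 \<xi> \<partial>?M) \<partial>?N) \<le> ennreal K"
      using majorant[OF test2 sieve2] by (elim bexE conjE)
    note W1_ge = W1_ge'[rule_format] and W2_ge = W2_ge'[rule_format]
    \<comment> \<open>A bound for the mean loss under the minimiser when evaluated at a competitor \<open>q\<close>. It is measurable in the data since \<open>q\<close> does not depend on them.\<close>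
    define B where "B W q X = ennreal k0 + ennreal k1 * (e2ennreal (KL ?M q (post X)) + (\<integral>\<^sup>+\<xi>. ennreal (post X \<xi>) * W \<xi> \<partial>?M))" for W q X
    define G where "G q = (\<integral>\<^sup>+X. e2ennreal (KL ?M q (post X)) \<partial>?P)" for q
    have B_int: "(\<integral>\<^sup>+X. B W q X \<partial>?P) \<le> ennreal D * (ennreal ((\<epsilon> n)\<^sup>2) + ennreal (1 / real n) * G q)"
      if q: "q \<in> \<Q>" and W [measurable]: "W \<in> borel_measurable ?M"
        and W_int: "(\<integral>\<^sup>+X. ennreal (p n \<xi>\<^sub>0 X) * (\<integral>\<^sup>+\<xi>. ennreal (post X \<xi>) * W \<xi> \<partial>?M) \<partial>?N) \<le> ennreal K" for W q
    proof -
      have "(\<integral>\<^sup>+X. B W q X \<partial>?P) \<le> ennreal k0 + ennreal k1 * (G q + ennreal K)"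
        unfolding B_def G_def P by (rule variational_expectation_bound_integral[OF \<xi>0M \<Q>[OF q] W W_int])
      also have "\<dots> = ennreal (k0 + k1 * K) + ennreal k1 * G q"
        using k K by (simp add: distrib_left ennreal_mult add_ac)
      also have "\<dots> \<le> ennreal (D * (\<epsilon> n)\<^sup>2) + ennreal (D * (1 / real n)) * G q"
      proof (intro add_mono mult_right_mono ennreal_leI)
        have n_inv: "1 / real n \<le> (\<epsilon> n)\<^sup>2" using n\<epsilon>[OF n] n by (simp add: field_simps)
        have "k0 = C1 * ((\<epsilon> n)\<^sup>2 + 1 / real n)" using n by (simp add: k0_def a_def field_simps)
        also have "\<dots> \<le> C1 * (2 * (\<epsilon> n)\<^sup>2)" using n_inv const by (intro mult_left_mono) auto
        finally have k0_le: "k0 \<le> 2 * C1 * (\<epsilon> n)\<^sup>2" by simp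
        have "k1 * K = C1 * K / s * (1 / real n)" by (simp add: k1_def)
        also have "\<dots> \<le> C1 * (K + 1) / s * (\<epsilon> n)\<^sup>2"
          using n_inv const K s by (intro mult_mono divide_right_mono) auto
        finally show "k0 + k1 * K \<le> D * (\<epsilon> n)\<^sup>2"
          using k0_le by (simp add: D_def distrib_right)
        have "C1 / s \<le> D" 
          using const K s by (simp add: D_def field_simps add_increasing)
        then have "C1 / s * (1 / real n) \<le> D * (1 / real n)" by (rule mult_right_mono) simp
        then show "k1 \<le> D * (1 / real n)" by (simp add: k1_def)
      qed simp
      also have "\<dots> = ennreal D * (ennreal ((\<epsilon> n)\<^sup>2) + ennreal (1 / real n) * G q)"
        using D by (simp only: ennreal_mult' less_imp_le distrib_left mult.assoc)
      finally show ?thesis .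
    qed
    have AE_fin: "AE X in ?P. evidence X < \<infinity>"
      unfolding P dens_measure_def using AE_evidence_finite by (subst AE_density) auto
    have AE_pos: "AE X in ?P. 0 < evidence X"
      unfolding P by (rule AE_evidence_pos[OF \<xi>0M A prior_A_pos const(6) renyi])
    have AE_good: "AE X in ?P. X \<in> space ?N \<and> 0 < evidence X \<and> evidence X < \<infinity>"
      using AE_fin AE_pos AE_space by eventually_elim (simp add: space_P)
    let ?m = "min \<delta> (1 - \<beta>)"
    have m: "0 < ?m" using \<delta> \<beta> by auto
    let ?E = "{X \<in> space ?P. \<bar>VB_value \<X> \<Theta> f g \<beta> (qstar n X) - true_value \<X> f g \<xi>\<^sub>0\<bar> > ereal (2 * \<eta>)}"
    have bound: "outer_measure_of ?P ?E
        \<le> ennreal (D / ?m + D / \<eta>) * (ennreal ((\<epsilon> n)\<^sup>2) + ennreal (1 / real n) * G q)" if q: "q \<in> \<Q>" for q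
    proof -
      have [measurable]: "q \<in> borel_measurable ?M" using \<Q>[OF q] by (simp add: prob_density_on_def)
      have "AE X in ?P. X \<in> ?E \<longrightarrow> ennreal ?m \<le> B W1 q X \<or> ennreal (2 * \<eta>) \<le> B W2 q X"
        using argmin[OF n] AE_good
      proof eventually_elim
        case (elim X)
        have qs: "qstar n X \<in> \<Q>" and "\<not> KL ?M q (post X) < KL ?M (qstar n X) (post X)"
          using elim(1) q unfolding is_arg_min_def post_eq by blast+
        then have "e2ennreal (KL ?M (qstar n X) (post X)) \<le> e2ennreal (KL ?M q (post X))"
          by (intro e2ennreal_mono) simp
        then have B_mono: "B W (qstar n X) X \<le> B W q X" for W
          unfolding B_def by (intro add_mono mult_left_mono order.refl) auto
        have var: "(\<integral>\<^sup>+\<xi>. ennreal (qstar n X \<xi>) * (ennreal k0 + ennreal k1 * ln_ennreal (W \<xi>)) \<partial>?M) \<le> B W q X"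
          if "W \<in> borel_measurable ?M" "\<And>\<xi>. 1 \<le> W \<xi>" for W
        proof -
          have "(\<integral>\<^sup>+\<xi>. ennreal (qstar n X \<xi>) * (ennreal k0 + ennreal k1 * ln_ennreal (W \<xi>)) \<partial>?M) \<le> B W (qstar n X) X"
            unfolding B_def by (rule variational_expectation_le[OF \<Q>[OF qs]]) (use elim(2) that in auto)
          also have "\<dots> \<le> B W q X" by (rule B_mono)
          finally show ?thesis .
        qed
        show ?case
        proof (rule impI, rule ccontr)
          assume E: "X \<in> ?E" and "\<not> (ennreal ?m \<le> B W1 q X \<or> ennreal (2 * \<eta>) \<le> B W2 q X)"
          then have small: "B W1 q X < ennreal ?m" "B W2 q X \<le> ennreal (2 * \<eta>)" by auto
          have "\<bar>VB_value \<X> \<Theta> f g \<beta> (qstar n X) - true_value \<X> f g \<xi>\<^sub>0\<bar> \<le> ereal (2 * \<eta>)"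
          proof (rule chance_constrained_value_stable[OF f g \<Q>[OF qs],
              where Hg = "\<lambda>\<xi>. ennreal k0 + ennreal k1 * ln_ennreal (W1 \<xi>)"
                and Hf = "\<lambda>\<xi>. ennreal k0 + ennreal k1 * ln_ennreal (W2 \<xi>)" and m = ?m])
            show "(\<integral>\<^sup>+\<xi>. ennreal (qstar n X \<xi>) * (ennreal k0 + ennreal k1 * ln_ennreal (W1 \<xi>)) \<partial>?M) < ennreal ?m"
              by (rule le_less_trans[OF var[OF W1 W1_ge] small(1)])
            show "(\<integral>\<^sup>+\<xi>. ennreal (qstar n X \<xi>) * (ennreal k0 + ennreal k1 * ln_ennreal (W2 \<xi>)) \<partial>?M) \<le> ennreal (2 * \<eta>)"
              by (rule order.trans[OF var[OF W2 W2_ge] small(2)])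
            show "1 \<le> ennreal k0 + ennreal k1 * ln_ennreal (W1 \<xi>)"
              if "x \<in> \<X>" "\<xi> \<in> \<Theta>" "(g x \<xi> \<le> 0) \<noteq> (g x \<xi>\<^sub>0 \<le> 0)" for x \<xi>
              by (rule order.trans[OF one_le_mean_loss1[where g = g and \<xi> = \<xi> and \<xi>\<^sub>0 = \<xi>\<^sub>0, OF n that(1,3)] bspec[OF mean_loss1 that(2)]])
            show "ennreal \<bar>f x \<xi> - f x \<xi>\<^sub>0\<bar> \<le> ennreal k0 + ennreal k1 * ln_ennreal (W2 \<xi>)"
              if "x \<in> \<X>" "\<xi> \<in> \<Theta>" for x \<xi>
              by (rule order.trans[OF abs_diff_le_mean_loss2[where f = f and \<xi> = \<xi> and \<xi>\<^sub>0 = \<xi>\<^sub>0, OF n that(1)] bspec[OF mean_loss2 that(2)]])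
          qed (use \<delta> \<eta> sol in auto)
          then show False using E by auto
        qed
      qed
      then have "outer_measure_of ?P ?E \<le> ennreal (1 / ?m) * (\<integral>\<^sup>+X. B W1 q X \<partial>?P) + ennreal (1 / (2 * \<eta>)) * (\<integral>\<^sup>+X. B W2 q X \<partial>?P)"
        using m \<eta> by (intro outer_measure_le_two_Markov) (auto simp: B_def)
      also have "\<dots> \<le> ennreal (1 / ?m) * (ennreal D * (ennreal ((\<epsilon> n)\<^sup>2) + ennreal (1 / real n) * G q))
          + ennreal (1 / \<eta>) * (ennreal D * (ennreal ((\<epsilon> n)\<^sup>2) + ennreal (1 / real n) * G q))"
        using \<eta> by (intro add_mono mult_mono B_int q W1 W2 W1_int W2_int ennreal_leI) (auto simp: field_simps)
      also have "\<dots> = ennreal (D / ?m + D / \<eta>) * (ennreal ((\<epsilon> n)\<^sup>2) + ennreal (1 / real n) * G q)"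
        using m \<eta> D by (simp add: distrib_right flip: mult.assoc ennreal_mult)
      finally show ?thesis .
    qed
    \<comment> \<open>The divergence from the posterior is almost surely nonnegative, so its expectation is a nonnegative integral.\<close>
    have eta: "eta_sq \<Theta> \<pi> \<Q> \<xi>\<^sub>0 p n = ereal (1 / real n) * (INF q\<in>\<Q>. enn2ereal (G q))"
      unfolding eta_sq_def
    proof (intro arg_cong[where f = "\<lambda>x. ereal (1 / real n) * x"] INF_cong refl)
      fix q assume q: "q \<in> \<Q>"
      have "AE X in ?P. 0 \<le> KL ?M q (post X)"
        using AE_good by eventually_elim (intro KL_nonneg_and_variational_bound(1) \<Q>[OF q] prob_density_post; simp)
      then show "ext_integral (dens_measure ?N (p n \<xi>\<^sub>0)) (\<lambda>X. KL ?M q (posterior \<Theta> \<pi> (p n) X)) = enn2ereal (G q)"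
        unfolding post_eq G_def P by (rule ext_integral_of_nonneg)
    qed
    have pos: "0 < D / ?m + D / \<eta>" using D m \<eta> by (intro add_pos_pos divide_pos_pos)
    show ?thesis
      unfolding eta by (rule le_affine_INF[OF pos _ _ bound]) (use n in auto)
  qed
  show ?thesis
    using D main by blast
qed

end
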